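(* Let $V$ be a vertex algebra and let $M,N,W$ be $V$-modules; assume that all tensor products of $V$-modules appearing below exist. Then there is a natural isomorphism of $\mathbf k$-vector spaces $$\tau_{M,N,W}:\mathrm{Hom}_V(M\otimes_VN,W)\longrightarrow \mathrm{Hom}_V(M,\mathrm{Vhom}(N,W))$$ sending $f:M\otimes_VN\to W$ to the map given by $\big[[\tau_{M,N,W}(f)](u)\big]_z(v)=f(u\otimes_zv)$ for $u\in M$, $v\in N$. In more detail, fixing any two of $M,N,W$, the maps $\tau_{M,N,W}$ form natural isomorphisms $\mathrm{Hom}_V(\square\otimes_VN,W)\to\mathrm{Hom}_V(\square,\mathrm{Vhom}(N,W))$, $\mathrm{Hom}_V(M\otimes_V\square,W)\to\mathrm{Hom}_V(M,\mathrm{Vhom}(\square,W))$ and $\mathrm{Hom}_V(M\otimes_VN,\square)\to\mathrm{Hom}_V(M,\mathrm{Vhom}(N,\square))$. For example, if $f\in\mathrm{Hom}_V(M,M')$, then $\tau_{M,N,W}\circ(f\otimes1_N)^*=f^*\circ\tau_{M',N,W}$ as maps $\mathrm{Hom}_V(M'\otimes_VN,W)\to\mathrm{Hom}_V(M,\mathrm{Vhom}(N,W))$.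
   Context: All vector spaces are over an algebraically closed field $\mathbf k$ of characteristic $0$. For $n\in\mathbb Z$, $(x+y)^n:=\sum_{k\ge 0}\binom nk x^{n-k}y^k$, i.e. binomials are expanded in nonnegative powers of the second-listed variable; a series evaluated at $z+x$, $z-x$, etc. is expanded by this rule. Vertex algebra: a vector space $V$ with a linear map $V\otimes V\to V((z))$, $a\otimes b\mapsto a_{\dot z}b=\sum_{n}(a_nb)z^{-n-1}$, a vector $\mathbf 1\in V$ and $d\in\mathrm{End}(V)$ such that for $a,b,c\in V$: $\mathbf 1_{\dot z}a=a$, $a_{\dot z}\mathbf 1=e^{zd}a$; $(da)_{\dot z}b=\frac{d}{dz}(a_{\dot z}b)$, $d(a_{\dot z}b)=(da)_{\dot z}b+a_{\dot z}(db)$; $a_{\dot z}b=e^{zd}(b_{\dot{-z}}a)$; and there is $l\in\mathbb N$ with $(z+w)^l(a_{\dot z}b)_{\dot w}c=(z+w)^l a_{\dot{z+w}}(b_{\dot w}c)$. $V$-module: a vector space $M$ with $d\in\mathrm{End}(M)$ and a linear map $V\otimes M\to M((z))$, $a\otimes u\mapsto a_{\dot z}u$, such that $\mathbf 1_{\dot z}u=u$; $(da)_{\dot z}u=\frac{d}{dz}(a_{\dot z}u)$, $d(a_{\dot z}u)=(da)_{\dot z}u+a_{\dot z}(du)$; and for all $a,b\in V$, $u\in M$ there is $l\in\mathbb N$ with $(z+x)^l(a_{\dot z}b)_{\dot x}u=(z+x)^la_{\dot{z+x}}(b_{\dot x}u)$. $\mathrm{Hom}_V(M,N)$ is the space of $V$-homomorphisms: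 linear maps $\varphi$ with $\varphi(a_{\dot z}u)=a_{\dot z}\varphi(u)$ and $\varphi(du)=d\varphi(u)$. Vertex bilinear map of type $(M,N;W)$: a bilinear map $F_z:M\times N\to W((z))$ with $F_z(du,v)=\frac{d}{dz}F_z(u,v)$, $F_z(u,dv)=(d-\frac{d}{dz})F_z(u,v)$, and such that for all $a\in V,u\in M,v\in N$ there are $n,k\in\mathbb N$ with $(z+x)^na_{\dot{z+x}}F_x(u,v)=(z+x)^nF_x(a_{\dot z}u,v)$ and $(z-x)^ka_{\dot z}F_x(u,v)=(z-x)^kF_x(u,a_{\dot z}v)$. Tensor product of $(M,N)$: a $V$-module $M\otimes_VN$ with a vertex bilinear map of type $(M,N;M\otimes_VN)$, written $(u,v)\mapsto u\otimes_zv\in(M\otimes_VN)((z))$, such that for every $V$-module $W$ and vertex bilinear map $I_z$ of type $(M,N;W)$ there is a unique $V$-homomorphism $\varphi:M\otimes_VN\to W$ with $I_z(u,v)=\varphi(u\otimes_zv)$ (homomorphisms are extended coefficientwise). For $V$-homomorphisms $f:M\to M'$, $g:N\to N'$, $f\otimes g:M\otimes_VN\to M'\otimes_VN'$ is the unique $V$-homomorphism with $(f\otimes g)(u\otimes_zv)=f(u)\otimes_zg(v)$. $\mathrm{Vhom}(M,N)$ is the space of vertex homomorphisms from $M$ to $N$: linear maps $f_z:M\to N((z))$ with $f_z(du)=(d-\frac{d}{dz})f_z(u)$ for all $u\in M$, and such that for every $a\in V$ there is $k\in\mathbb N$ with $(z-x)^ka_{\dot z}(f_x(u))=(z-x)^kf_x(a_{\dot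 z}u)$ for all $u\in M$. It is a $V$-module with $(df)_z=\frac{d}{dz}f_z$ and $(a_{\dot z}f)_y(u)=a_{\dot{z+y}}(f_y(u))-f_y(a_{\dot{z+y}}u-a_{\dot{y+z}}u)$. For a $V$-homomorphism $f$, $f_*$ and $f^*$ denote the maps induced by post-composition and pre-composition with $f$ on $\mathrm{Hom}_V$ and on $\mathrm{Vhom}$. *)

theory Defs
  imports
    Complex_Main
    "HOL-Library.FuncSet"
    "HOL-Library.Function_Algebras"
    "HOL-Library.Groups_Big_Fun"
    "HOL-Computational_Algebra.Polynomial"
begin

text \<open>
  A vector space is a subspace \<open>carr M\<close> of an ambient vector space, the latter being a type
  of class \<^class>\<open>ab_group_add\<close> with a scalar multiplication \<open>scl M\<close>. Carriers are needed
  because the universal property of a tensor product quantifies over all modules, and because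
  \<open>Vhom\<close> is a space of functions. Only values on carriers are constrained, except that linear maps
  which are elements of a space of maps are extended by \<open>0\<close> outside the carrier, so that equality
  of maps is equality of functions.

  A formal series in \<open>z\<close> is the function \<open>int \<Rightarrow> 'a\<close> taking \<open>n\<close> to the coefficient of \<open>z\<^sup>n\<close>; a formal
  series in two variables is a function \<open>int \<Rightarrow> int \<Rightarrow> 'a\<close>, the exponent of the first variable coming
  first. In particular \<open>vop M a u n\<close> is the coefficient of \<open>z\<^sup>n\<close> in \<open>a\<close> acting on \<open>u\<close>, that is
  the mode numbered \<open>- n - 1\<close>.
\<close>

record ('k, 'v, 'a) vmod =
  carr :: "'a set"
  scl :: "'k \<Rightarrow> 'a \<Rightarrow> 'a"
  der :: "'a \<Rightarrow> 'a"
  vop :: "'v \<Rightarrow> 'a \<Rightarrow> int \<Rightarrow> 'a"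

record ('k, 'v) valg = "('k, 'v, 'v) vmod" +
  vac :: "'v"

subsection \<open>Linear algebra on carriers\<close>

definition vspace_on :: "('k::field \<Rightarrow> 'a::ab_group_add \<Rightarrow> 'a) \<Rightarrow> 'a set \<Rightarrow> bool" where
  "vspace_on s S \<longleftrightarrow> vector_space s \<and> module.subspace s S"

definition linear_on ::
  "('k \<Rightarrow> 'a::plus \<Rightarrow> 'a) \<Rightarrow> 'a set \<Rightarrow> ('k \<Rightarrow> 'b::plus \<Rightarrow> 'b) \<Rightarrow> ('a \<Rightarrow> 'b) \<Rightarrow> bool" where
  "linear_on s S t f \<longleftrightarrow>
     (\<forall>x\<in>S. \<forall>y\<in>S. f (x + y) = f x + f y) \<and> (\<forall>c. \<forall>x\<in>S. f (s c x) = t c (f x))"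

definition vspace_iso ::
  "('k::field \<Rightarrow> 'a::ab_group_add \<Rightarrow> 'a) \<Rightarrow> 'a set \<Rightarrow> ('k \<Rightarrow> 'b::ab_group_add \<Rightarrow> 'b) \<Rightarrow> 'b set \<Rightarrow>
   ('a \<Rightarrow> 'b) \<Rightarrow> bool" where
  "vspace_iso s S t T f \<longleftrightarrow>
     vspace_on s S \<and> vspace_on t T \<and> linear_on s S t f \<and> bij_betw f S T"

definition pointwise :: "('k \<Rightarrow> 'b \<Rightarrow> 'b) \<Rightarrow> 'k \<Rightarrow> ('a \<Rightarrow> 'b) \<Rightarrow> 'a \<Rightarrow> 'b" where
  "pointwise s c f = (\<lambda>x. s c (f x))"

definition commuting_square ::
  "'a set \<Rightarrow> 'b set \<Rightarrow> 'c set \<Rightarrow> 'd set \<Rightarrow>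
   ('a \<Rightarrow> 'b) \<Rightarrow> ('a \<Rightarrow> 'c) \<Rightarrow> ('b \<Rightarrow> 'd) \<Rightarrow> ('c \<Rightarrow> 'd) \<Rightarrow> bool" where
  "commuting_square A B C D p q r s \<longleftrightarrow>
     p \<in> A \<rightarrow> B \<and> q \<in> A \<rightarrow> C \<and> r \<in> B \<rightarrow> D \<and> s \<in> C \<rightarrow> D \<and>
     (\<forall>x\<in>A. r (p x) = s (q x))"

subsection \<open>Formal series\<close>

definition laurent :: "'a::zero set \<Rightarrow> (int \<Rightarrow> 'a) set" where
  "laurent S = {g. (\<forall>n. g n \<in> S) \<and> (\<exists>n0. \<forall>n<n0. g n = 0)}"

definition const_series :: "'a::zero \<Rightarrow> int \<Rightarrow> 'a" where
  "const_series a = (\<lambda>n. if n = 0 then a else 0)"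

definition ddz :: "('k::ring_1 \<Rightarrow> 'a \<Rightarrow> 'a) \<Rightarrow> (int \<Rightarrow> 'a) \<Rightarrow> int \<Rightarrow> 'a" where
  "ddz s g = (\<lambda>n. s (of_int (n + 1)) (g (n + 1)))"

text \<open>The series \<open>e\<^bsup>zd\<^esup> g(z)\<close>; the sum has finite support if \<open>g\<close> is a Laurent series.\<close>

definition exp_der ::
  "('k::field_char_0 \<Rightarrow> 'a::ab_group_add \<Rightarrow> 'a) \<Rightarrow> ('a \<Rightarrow> 'a) \<Rightarrow> (int \<Rightarrow> 'a) \<Rightarrow> int \<Rightarrow> 'a" where
  "exp_der s d g = (\<lambda>n. Sum_any (\<lambda>k::nat. s (1 / fact k) ((d ^^ k) (g (n - int k)))))"

text \<open>The product \<open>(z + \<epsilon>x)\<^sup>l P(z, x)\<close> for a natural number \<open>l\<close>, used with \<open>\<epsilon> = 1\<close> and \<open>\<epsilon> = - 1\<close>.\<close>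

definition binom_mult ::
  "('k::comm_ring_1 \<Rightarrow> 'a::ab_group_add \<Rightarrow> 'a) \<Rightarrow> 'k \<Rightarrow> nat \<Rightarrow> (int \<Rightarrow> int \<Rightarrow> 'a) \<Rightarrow> int \<Rightarrow> int \<Rightarrow> 'a" where
  "binom_mult s \<epsilon> l P =
     (\<lambda>i j. \<Sum>k\<le>l. s (of_nat (l choose k) * \<epsilon> ^ k) (P (i - int (l - k)) (j - int k)))"

text \<open>
  For \<open>g(x)\<close> in \<open>M((x))\<close>, the series in \<open>z, x\<close> obtained by letting \<open>a\<close> act on \<open>g(x)\<close> with formal
  variable \<open>z + x\<close>: as \<open>(z + x)\<^sup>m\<close> is the sum of \<open>(m choose k) z\<^bsup>m-k\<^esup> x\<^sup>k\<close> over \<open>k \<ge> 0\<close>, the monomial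
  \<open>z\<^sup>i x\<^sup>j\<close> collects the contributions with \<open>m = i + k\<close> and the coefficient of \<open>x\<^bsup>j-k\<^esup>\<close> in \<open>g\<close>.
\<close>

definition shifted_op ::
  "('k::field_char_0, 'v, 'a::ab_group_add, 'z) vmod_scheme \<Rightarrow> 'v \<Rightarrow> (int \<Rightarrow> 'a) \<Rightarrow> int \<Rightarrow> int \<Rightarrow> 'a"
  where
  "shifted_op M a g = (\<lambda>i j. Sum_any (\<lambda>k::nat.
     scl M (of_int (i + int k) gchoose k) (vop M a (g (j - int k)) (i + int k))))"

text \<open>
  The difference of the actions of \<open>a\<close> on \<open>u\<close> with formal variables \<open>z + y\<close> and \<open>y + z\<close>, as a series
  in \<open>z, y\<close>. Nonnegative powers cancel, so for each exponent \<open>i\<close> of \<open>z\<close> only finitely many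
  coefficients are nonzero.
\<close>

definition swap_diff ::
  "('k::field_char_0, 'v, 'a::ab_group_add, 'z) vmod_scheme \<Rightarrow> 'v \<Rightarrow> 'a \<Rightarrow> int \<Rightarrow> int \<Rightarrow> 'a" where
  "swap_diff M a u = (\<lambda>i p.
     (if 0 \<le> p then scl M (of_int (i + p) gchoose nat p) (vop M a u (i + p)) else 0) -
     (if 0 \<le> i then scl M (of_int (i + p) gchoose nat i) (vop M a u (i + p)) else 0))"

subsection \<open>Vertex algebras and modules\<close>

definition vertex_module ::
  "('k::field_char_0, 'v::ab_group_add) valg \<Rightarrow>
   ('k, 'v, 'a::ab_group_add, 'z) vmod_scheme \<Rightarrow> bool" where
  "vertex_module V M \<longleftrightarrow>
     vspace_on (scl M) (carr M) \<and>
     der M \<in> carr M \<rightarrow> carr M \<and> linear_on (scl M) (carr M) (scl M) (der M) \<and>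
     (\<forall>a\<in>carr V. \<forall>u\<in>carr M. vop M a u \<in> laurent (carr M)) \<and>
     (\<forall>a\<in>carr V. linear_on (scl M) (carr M) (pointwise (scl M)) (vop M a)) \<and>
     (\<forall>u\<in>carr M. linear_on (scl V) (carr V) (pointwise (scl M)) (\<lambda>a. vop M a u)) \<and>
     (\<forall>u\<in>carr M. vop M (vac V) u = const_series u) \<and>
     (\<forall>a\<in>carr V. \<forall>u\<in>carr M. vop M (der V a) u = ddz (scl M) (vop M a u)) \<and>
     (\<forall>a\<in>carr V. \<forall>u\<in>carr M. \<forall>n.
        der M (vop M a u n) = vop M (der V a) u n + vop M a (der M u) n) \<and>
     (\<forall>a\<in>carr V. \<forall>b\<in>carr V. \<forall>u\<in>carr M. \<exists>l.
        binom_mult (scl M) 1 l (\<lambda>i j. vop M (vop V a b i) u j) =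
        binom_mult (scl M) 1 l (shifted_op M a (vop M b u)))"

text \<open>
  The module axioms for \<open>V\<close> acting on itself are literally the remaining axioms of a vertex algebra.
\<close>

definition vertex_algebra :: "('k::field_char_0, 'v::ab_group_add) valg \<Rightarrow> bool" where
  "vertex_algebra V \<longleftrightarrow>
     vac V \<in> carr V \<and> vertex_module V V \<and>
     (\<forall>a\<in>carr V. vop V a (vac V) = exp_der (scl V) (der V) (const_series a)) \<and>
     (\<forall>a\<in>carr V. \<forall>b\<in>carr V.
        vop V a b = exp_der (scl V) (der V) (\<lambda>n. scl V ((- 1) powi n) (vop V b a n)))"

definition Hom ::
  "('k, 'v) valg \<Rightarrow> ('k, 'v, 'a::ab_group_add) vmod \<Rightarrow> ('k, 'v, 'b::ab_group_add) vmod \<Rightarrow>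
   ('a \<Rightarrow> 'b) set" where
  "Hom V M N = {\<phi>.
     \<phi> \<in> carr M \<rightarrow> carr N \<and> (\<forall>u. u \<notin> carr M \<longrightarrow> \<phi> u = 0) \<and>
     linear_on (scl M) (carr M) (scl N) \<phi> \<and>
     (\<forall>a\<in>carr V. \<forall>u\<in>carr M. \<forall>n. \<phi> (vop M a u n) = vop N a (\<phi> u) n) \<and>
     (\<forall>u\<in>carr M. \<phi> (der M u) = der N (\<phi> u))}"

definition id_hom :: "('k, 'v, 'a::zero) vmod \<Rightarrow> 'a \<Rightarrow> 'a" where
  "id_hom M = (\<lambda>u. if u \<in> carr M then u else 0)"

subsection \<open>Vertex bilinear maps and tensor products\<close>

definition vertex_bilinear ::
  "('k::field_char_0, 'v) valg \<Rightarrow> ('k, 'v, 'm::ab_group_add) vmod \<Rightarrow>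
   ('k, 'v, 'n::ab_group_add) vmod \<Rightarrow> ('k, 'v, 'w::ab_group_add) vmod \<Rightarrow>
   ('m \<Rightarrow> 'n \<Rightarrow> int \<Rightarrow> 'w) \<Rightarrow> bool" where
  "vertex_bilinear V M N W F \<longleftrightarrow>
     (\<forall>u\<in>carr M. \<forall>v\<in>carr N. F u v \<in> laurent (carr W)) \<and>
     (\<forall>u\<in>carr M. linear_on (scl N) (carr N) (pointwise (scl W)) (F u)) \<and>
     (\<forall>v\<in>carr N. linear_on (scl M) (carr M) (pointwise (scl W)) (\<lambda>u. F u v)) \<and>
     (\<forall>u\<in>carr M. \<forall>v\<in>carr N. F (der M u) v = ddz (scl W) (F u v)) \<and>
     (\<forall>u\<in>carr M. \<forall>v\<in>carr N. \<forall>i. F u (der N v) i = der W (F u v i) - ddz (scl W) (F u v) i) \<and>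
     (\<forall>a\<in>carr V. \<forall>u\<in>carr M. \<forall>v\<in>carr N. \<exists>n k.
        binom_mult (scl W) 1 n (shifted_op W a (F u v)) =
        binom_mult (scl W) 1 n (\<lambda>i j. F (vop M a u i) v j) \<and>
        binom_mult (scl W) (- 1) k (\<lambda>i j. vop W a (F u v j) i) =
        binom_mult (scl W) (- 1) k (\<lambda>i j. F u (vop N a v i) j))"

text \<open>
  The universal property ranges over all modules carried by subsets of the type underlying \<open>T\<close>,
  which plays the role of a universe.
\<close>

definition is_tensor ::
  "('k::field_char_0, 'v::ab_group_add) valg \<Rightarrow> ('k, 'v, 'm::ab_group_add) vmod \<Rightarrow>
   ('k, 'v, 'n::ab_group_add) vmod \<Rightarrow> ('k, 'v, 'u::ab_group_add) vmod \<Rightarrow>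
   ('m \<Rightarrow> 'n \<Rightarrow> int \<Rightarrow> 'u) \<Rightarrow> bool" where
  "is_tensor V M N T tens \<longleftrightarrow>
     vertex_module V T \<and> vertex_bilinear V M N T tens \<and>
     (\<forall>(W :: ('k, 'v, 'u) vmod) I. vertex_module V W \<longrightarrow> vertex_bilinear V M N W I \<longrightarrow>
        (\<exists>!\<phi>. \<phi> \<in> Hom V T W \<and> (\<forall>u\<in>carr M. \<forall>v\<in>carr N. \<forall>i. I u v i = \<phi> (tens u v i))))"

text \<open>
  The map \<open>f \<otimes> g\<close> from the tensor product \<open>(T, tens)\<close> of \<open>M, N\<close> to a tensor product \<open>(T', tens')\<close>
  of the targets of \<open>f\<close> and \<open>g\<close>.
\<close>

definition tensor_hom ::
  "('k, 'v) valg \<Rightarrow> ('k, 'v, 'm) vmod \<Rightarrow> ('k, 'v, 'n) vmod \<Rightarrow>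
   ('k, 'v, 'u::ab_group_add) vmod \<Rightarrow> ('m \<Rightarrow> 'n \<Rightarrow> int \<Rightarrow> 'u) \<Rightarrow>
   ('k, 'v, 'w::ab_group_add) vmod \<Rightarrow> ('p \<Rightarrow> 'q \<Rightarrow> int \<Rightarrow> 'w) \<Rightarrow>
   ('m \<Rightarrow> 'p) \<Rightarrow> ('n \<Rightarrow> 'q) \<Rightarrow> 'u \<Rightarrow> 'w" where
  "tensor_hom V M N T tens T' tens' f g =
     (THE h. h \<in> Hom V T T' \<and>
        (\<forall>u\<in>carr M. \<forall>v\<in>carr N. \<forall>i. h (tens u v i) = tens' (f u) (g v) i))"

subsection \<open>Vertex homomorphisms\<close>

definition Vhom ::
  "('k::field_char_0, 'v) valg \<Rightarrow> ('k, 'v, 'n::ab_group_add) vmod \<Rightarrow>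
   ('k, 'v, 'w::ab_group_add) vmod \<Rightarrow> ('k, 'v, 'n \<Rightarrow> int \<Rightarrow> 'w) vmod" where
  "Vhom V N W =
     \<lparr>carr = {f.
        (\<forall>u\<in>carr N. f u \<in> laurent (carr W)) \<and> (\<forall>u. u \<notin> carr N \<longrightarrow> f u = 0) \<and>
        linear_on (scl N) (carr N) (pointwise (scl W)) f \<and>
        (\<forall>u\<in>carr N. \<forall>i. f (der N u) i = der W (f u i) - ddz (scl W) (f u) i) \<and>
        (\<forall>a\<in>carr V. \<exists>k. \<forall>u\<in>carr N.
           binom_mult (scl W) (- 1) k (\<lambda>i j. vop W a (f u j) i) =
           binom_mult (scl W) (- 1) k (\<lambda>i j. f (vop N a u i) j))},
      scl = pointwise (pointwise (scl W)),
      der = (\<lambda>f u. ddz (scl W) (f u)),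
      vop = (\<lambda>a f i u j.
        if u \<in> carr N
        then shifted_op W a (f u) i j - Sum_any (\<lambda>p::int. f (swap_diff N a u i p) (j - p))
        else 0)\<rparr>"

definition Vhom_push :: "('w \<Rightarrow> 'x) \<Rightarrow> ('n \<Rightarrow> int \<Rightarrow> 'w) \<Rightarrow> 'n \<Rightarrow> int \<Rightarrow> 'x" where
  "Vhom_push h f = (\<lambda>u i. h (f u i))"

definition Vhom_pull :: "('p \<Rightarrow> 'n) \<Rightarrow> ('n \<Rightarrow> int \<Rightarrow> 'w) \<Rightarrow> 'p \<Rightarrow> int \<Rightarrow> 'w" where
  "Vhom_pull h f = (\<lambda>u. f (h u))"

definition tau ::
  "('k, 'v, 'm) vmod \<Rightarrow> ('k, 'v, 'n) vmod \<Rightarrow> ('m \<Rightarrow> 'n \<Rightarrow> int \<Rightarrow> 'u) \<Rightarrow>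
   ('u \<Rightarrow> 'w::zero) \<Rightarrow> 'm \<Rightarrow> 'n \<Rightarrow> int \<Rightarrow> 'w" where
  "tau M N tens f =
     (\<lambda>u v i. if u \<in> carr M \<and> v \<in> carr N then f (tens u v i) else 0)"

end

theory Submission
  imports Defs
begin

text \<open>
  Let \<open>F\<close> be a vertex bilinear map and put \<open>A(z, x) = a\<^sub>z F\<^sub>x(u, v)\<close>, \<open>B(z, x) = F\<^sub>x(u, a\<^sub>z v)\<close> and
  \<open>C(z, x) = F\<^sub>x(a\<^sub>z u, v)\<close>. Homomorphisms from \<open>M\<close> to \<open>Vhom(N, W)\<close> are exactly the vertex bilinear
  maps, the compatibility with the action of \<open>a\<close> being the Jacobi identity
  \<open>C(y, x) = A(y + x, x) - (B(y + x, x) - B(x + y, x))\<close>. Multiplication by a power of \<open>y + x\<close>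
  kills the bracket, so the identity implies weak associativity. Conversely, if \<open>A\<close> and \<open>B\<close> agree
  after multiplication by \<open>(z - x)\<^sup>k\<close>, then \<open>A(y + x, x)\<close> and the bracket have the same coefficients
  at \<open>y\<^sup>i\<close> for \<open>i < - k\<close>; the difference of the two sides of the identity is thus bounded below in
  \<open>y\<close> and killed by a power of \<open>y + x\<close>, hence zero. The identity also shows that the order of the
  pole of \<open>a\<^sub>z u\<close> is a valid exponent in weak commutativity. This exponent does not depend on \<open>v\<close>,
  as the definition of \<open>Vhom\<close> requires. The universal property now gives the bijection. Naturality
  is a direct computation, where the maps induced on the \<open>Vhom\<close> side land in the right space because
  \<open>\<tau>\<close> is onto.
\<close>

section \<open>Substitution in formal series\<close>

text \<open>The coefficient of \<open>y\<^sup>i x\<^sup>p\<close> in \<open>(y + x)\<^bsup>i+p\<^esup>\<close>; accordingly \<open>fwd p i\<close> is its coefficient in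
  \<open>(x + y)\<^bsup>i+p\<^esup>\<close>.\<close>

definition fwd :: "int \<Rightarrow> int \<Rightarrow> 'k::field_char_0" where
  "fwd i p = (if 0 \<le> p then of_int (i + p) gchoose nat p else 0)"

text \<open>Coefficient form of \<open>(y + x)^n = (y + x) (y + x)^(n-1)\<close>, valid for negative
  \<open>n\<close> too.\<close>

lemma fwd_pascal: "fwd i p = fwd (i - 1) p + (fwd i (p - 1) :: 'k::field_char_0)"
proof (cases "p \<le> 0")
  case False
  define k where "k = nat (p - 1)"
  have p: "p = int (Suc k)" using False by (simp add: k_def)
  have "(of_int (i + p) :: 'k) = of_int (i + p - 1) + 1" by simp
  then show ?thesis
    using gbinomial_Suc_Suc[of "of_int (i + p - 1) :: 'k" k]
    unfolding fwd_def p by (simp add: algebra_simps nat_add_distrib)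
qed (auto simp: fwd_def)

lemma fwd_zero_right [simp]: "fwd i 0 = 1"
  by (simp add: fwd_def)

lemma fwd_eq_0:
  assumes "i < 0" "0 \<le> i + p"
  shows "fwd i p = (0 :: 'k::field_char_0)"
proof -
  have "fwd i p = (of_nat (nat (i + p) choose nat p) :: 'k)"
    using assms by (simp add: fwd_def binomial_gbinomial)
  then show ?thesis using assms by (simp add: binomial_eq_0)
qed

text \<open>For a nonnegative exponent the power is a polynomial, so the order of the two variables
  does not matter.\<close>

lemma fwd_sym:
  assumes "0 \<le> i + p"
  shows "fwd i p = (fwd p i :: 'k::field_char_0)"
proof (cases "0 \<le> i \<and> 0 \<le> p")
  case True
  then obtain m n where "i = int m" "p = int n" by (metis nonneg_int_cases)
  then have "fwd i p = (of_nat ((m + n) choose n) :: 'k)" "fwd p i = (of_nat ((n + m) choose m) :: 'k)"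
    by (simp_all add: fwd_def binomial_gbinomial)
  then show ?thesis
    using binomial_symmetric[of n "m + n"] by (simp add: add.commute)
next
  case False
  then show ?thesis
    using assms fwd_eq_0[of i p, where 'k = 'k] fwd_eq_0[of p i, where 'k = 'k] by (auto simp: fwd_def add.commute)
qed

text \<open>The coefficient of \<open>y^i x^p\<close> in
  \<open>(y + x)^(i+p) - (x + y)^(i+p)\<close>, the scalar part of \<open>swap_diff\<close>.\<close>

definition swp :: "int \<Rightarrow> int \<Rightarrow> 'k::field_char_0" where
  "swp i p = fwd i p - fwd p i"

lemma swp_pascal: "swp i p = swp (i - 1) p + (swp i (p - 1) :: 'k::field_char_0)"
  using fwd_pascal[of i p, where 'k = 'k] fwd_pascal[of p i, where 'k = 'k] by (simp add: swp_def)

lemma swp_eq_0: "0 \<le> i + p \<Longrightarrow> swp i p = (0 :: 'k::field_char_0)"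
  using fwd_sym[of i p, where 'k = 'k] by (simp add: swp_def)

text \<open>\<open>(x + y)^n\<close> contains no negative powers of \<open>y\<close>. This makes the
  bracket comparable with \<open>A(y + x, x)\<close> at negative powers of \<open>y\<close>.\<close>

lemma swp_eq_fwd: "i < 0 \<Longrightarrow> swp i p = fwd i p"
  by (simp add: swp_def fwd_def)

locale char_0_vector_space = vector_space scale
  for scale :: "'k::field_char_0 \<Rightarrow> 'a::ab_group_add \<Rightarrow> 'a"
begin

section \<open>Multiplication by powers of a linear form in z and x\<close>

lemma binom_mult_0 [simp]: "binom_mult scale \<epsilon> 0 P = P"
  by (simp add: binom_mult_def)

lemma binom_mult_Suc:
  "binom_mult scale \<epsilon> (Suc l) P =
   binom_mult scale \<epsilon> l (\<lambda>i j. P (i - 1) j + scale \<epsilon> (P i (j - 1)))"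
proof (intro ext)
  fix i j
  let ?Q = "\<lambda>k. P (i - int (Suc l - k)) (j - int k)"
  have "binom_mult scale \<epsilon> (Suc l) P i j =
      ?Q 0 + (\<Sum>k\<le>l. scale (of_nat (Suc l choose Suc k) * \<epsilon> ^ Suc k) (?Q (Suc k)))"
    unfolding binom_mult_def by (subst sum.atMost_Suc_shift) simp
  also have "\<dots> = (?Q 0 + (\<Sum>k\<le>l. scale (of_nat (l choose Suc k) * \<epsilon> ^ Suc k) (?Q (Suc k)))) +
      (\<Sum>k\<le>l. scale (of_nat (l choose k) * \<epsilon> ^ Suc k) (?Q (Suc k)))"
    by (simp add: algebra_simps sum.distrib scale_left_distrib)
  also have "?Q 0 + (\<Sum>k\<le>l. scale (of_nat (l choose Suc k) * \<epsilon> ^ Suc k) (?Q (Suc k))) =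
      (\<Sum>k\<le>Suc l. scale (of_nat (l choose k) * \<epsilon> ^ k) (?Q k))"
    by (subst sum.atMost_Suc_shift) simp
  also have "\<dots> = (\<Sum>k\<le>l. scale (of_nat (l choose k) * \<epsilon> ^ k) (?Q k))"
    by (simp add: binomial_eq_0)
  also have "\<dots> + (\<Sum>k\<le>l. scale (of_nat (l choose k) * \<epsilon> ^ Suc k) (?Q (Suc k))) =
      binom_mult scale \<epsilon> l (\<lambda>i j. P (i - 1) j + scale \<epsilon> (P i (j - 1))) i j"
    unfolding binom_mult_def sum.distrib[symmetric]
    by (intro sum.cong refl)
      (auto simp: scale_right_distrib Suc_diff_le algebra_simps)
  finally show "binom_mult scale \<epsilon> (Suc l) P i j =
    binom_mult scale \<epsilon> l (\<lambda>i j. P (i - 1) j + scale \<epsilon> (P i (j - 1))) i j" .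
qed

lemma binom_mult_diff:
  "binom_mult scale \<epsilon> l (\<lambda>i j. P i j - Q i j) =
   (\<lambda>i j. binom_mult scale \<epsilon> l P i j - binom_mult scale \<epsilon> l Q i j)"
  by (simp add: binom_mult_def scale_right_diff_distrib sum_subtractf)

text \<open>Peeling the new factor off on the outside leaves \<open>P\<close> untouched, which suits
  inductions on the exponent.\<close>

lemma binom_mult_Suc':
  "binom_mult scale \<epsilon> (Suc l) P =
   (\<lambda>i j. binom_mult scale \<epsilon> l P (i - 1) j + scale \<epsilon> (binom_mult scale \<epsilon> l P i (j - 1)))"
proof (intro ext)
  fix i j
  show "binom_mult scale \<epsilon> (Suc l) P i j =
    binom_mult scale \<epsilon> l P (i - 1) j + scale \<epsilon> (binom_mult scale \<epsilon> l P i (j - 1))"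
    unfolding binom_mult_Suc
    by (simp add: binom_mult_def sum.distrib scale_right_distrib scale_sum_right algebra_simps)
qed

lemmas binom_mult_step = trans[OF binom_mult_Suc[symmetric] binom_mult_Suc']

text \<open>On series bounded below in \<open>z\<close> the factor \<open>z + \<epsilon>x\<close> is
  invertible, with \<open>\<epsilon>x\<close> as its leading term; vanishing therefore propagates
  upwards from row \<open>m\<close>.\<close>

lemma binom_mult_cancel:
  assumes "\<epsilon> \<noteq> 0" and "\<And>i j. i < m \<Longrightarrow> P i j = 0" and "\<And>i j. binom_mult scale \<epsilon> l P i j = 0"
  shows "P i j = 0"
  using assms(3)
proof (induction l arbitrary: i j)
  case (Suc l)
  define G where "G = binom_mult scale \<epsilon> l P"
  have low: "G i j = 0" if "i < m" for i j
    unfolding G_def binom_mult_def using that by (intro sum.neutral) (simp add: assms(2))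
  have step: "G (i - 1) j + scale \<epsilon> (G i (j - 1)) = 0" for i j
    using Suc.prems[of i j] by (simp add: binom_mult_Suc' G_def)
  have "G (m + int n) j = 0" for n j
  proof (induction n arbitrary: j)
    case 0
    \<comment> \<open>The row below vanishes, so the equation at \<open>x^(j+1)\<close> leaves only
      \<open>\<epsilon>\<close> times the coefficient at \<open>x^j\<close>.\<close>
    show ?case using step[of m "j + 1"] low[of "m - 1"] \<open>\<epsilon> \<noteq> 0\<close> by simp
  next
    case (Suc n)
    show ?case using step[of "m + int (Suc n)" "j + 1"] Suc \<open>\<epsilon> \<noteq> 0\<close> by simp
  qed
  then have "G i j = 0" for i j
    using low[of i j] by (cases "i < m") (auto simp: not_less zle_iff_zadd)
  then show ?case using Suc.IH by (simp add: G_def)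
qed simp

text \<open>For \<open>c = fwd\<close> this is \<open>P(y + x, x)\<close>, for \<open>c = swp\<close> it is \<open>P(y + x, x) - P(x + y, x)\<close>.\<close>

definition substc :: "(int \<Rightarrow> int \<Rightarrow> 'k) \<Rightarrow> (int \<Rightarrow> int \<Rightarrow> 'a) \<Rightarrow> int \<Rightarrow> int \<Rightarrow> 'a" where
  "substc c P i j = Sum_any (\<lambda>p. scale (c i p) (P (i + p) (j - p)))"

text \<open>The index \<open>i'\<close> of \<open>P\<close> is decoupled from the index
  \<open>i\<close> of \<open>c\<close> so that the condition survives multiplying \<open>P\<close>
  by monomials.\<close>

definition substable :: "(int \<Rightarrow> int \<Rightarrow> 'k) \<Rightarrow> (int \<Rightarrow> int \<Rightarrow> 'a) \<Rightarrow> bool" where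
  "substable c P \<longleftrightarrow> (\<forall>i i' j. finite {p. c i p \<noteq> 0 \<and> P (i' + p) (j - p) \<noteq> 0})"

section \<open>Finiteness and linearity of substitution\<close>

lemma substableD:
  assumes "substable c P"
  shows "finite {p. scale (c i p) (P (i' + p) (j - p)) \<noteq> 0}"
  using assms unfolding substable_def by simp

lemma substable_fwd:
  assumes "\<And>i j. j < m \<Longrightarrow> P i j = 0"
  shows "substable fwd P"
  unfolding substable_def
proof (intro allI)
  fix i i' j
  show "finite {p. (fwd i p :: 'k) \<noteq> 0 \<and> P (i' + p) (j - p) \<noteq> 0}"
    by (rule finite_subset[of _ "{0..j - m}"])
      (use assms in \<open>force simp: fwd_def not_less[symmetric]\<close>)+
qed

text \<open>Only negative total exponents matter to \<open>swp\<close>, which bounds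
  \<open>p\<close> above; the lower bound of \<open>P\<close> in its first variable bounds
  \<open>p\<close> below.\<close>

lemma substable_swp:
  assumes "\<And>i j. i < m \<Longrightarrow> P i j = 0"
  shows "substable swp P"
  unfolding substable_def
proof (intro allI)
  fix i i' j
  show "finite {p. (swp i p :: 'k) \<noteq> 0 \<and> P (i' + p) (j - p) \<noteq> 0}"
  proof (rule finite_subset[of _ "{m - i'..- i}"])
    show "{p. (swp i p :: 'k) \<noteq> 0 \<and> P (i' + p) (j - p) \<noteq> 0} \<subseteq> {m - i'..- i}"
    proof
      fix p assume p: "p \<in> {p. (swp i p :: 'k) \<noteq> 0 \<and> P (i' + p) (j - p) \<noteq> 0}"
      then have "\<not> 0 \<le> i + p" using swp_eq_0 by blast
      moreover have "\<not> i' + p < m" using p assms by blast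
      ultimately show "p \<in> {m - i'..- i}" by simp
    qed
  qed simp
qed

lemma substable_shift:
  assumes "substable c P"
  shows "substable c (\<lambda>i j. P (i - r) (j - t))"
  unfolding substable_def
proof (intro allI)
  fix i i' j
  have "finite {p. c i p \<noteq> 0 \<and> P ((i' - r) + p) ((j - t) - p) \<noteq> 0}"
    using assms unfolding substable_def by blast
  then show "finite {p. c i p \<noteq> 0 \<and> P (i' + p - r) (j - p - t) \<noteq> 0}"
    by (simp add: algebra_simps)
qed

lemma substable_lincomb:
  assumes "substable c P" "substable c Q"
  shows "substable c (\<lambda>i j. P i j + scale \<epsilon> (Q i j))"
  unfolding substable_def
proof (intro allI)
  fix i i' j
  show "finite {p. c i p \<noteq> 0 \<and> P (i' + p) (j - p) + scale \<epsilon> (Q (i' + p) (j - p)) \<noteq> 0}"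
    by (rule finite_subset[of _ "{p. c i p \<noteq> 0 \<and> P (i' + p) (j - p) \<noteq> 0} \<union>
        {p. c i p \<noteq> 0 \<and> Q (i' + p) (j - p) \<noteq> 0}"])
      (use assms in \<open>auto simp: substable_def\<close>)
qed

lemma substable_step:
  assumes "substable c P"
  shows "substable c (\<lambda>i j. P (i - 1) j + scale \<epsilon> (P i (j - 1)))"
  using substable_lincomb[OF substable_shift[OF assms, of 1 0] substable_shift[OF assms, of 0 1]]
  by simp

lemma substable_binom_mult:
  "substable c P \<Longrightarrow> substable c (binom_mult scale \<epsilon> l P)"
  by (induction l) (simp_all add: binom_mult_Suc' substable_step)

lemma substc_add:
  assumes "substable c P" "substable c Q"
  shows "substc c (\<lambda>i j. P i j + Q i j) i j = substc c P i j + substc c Q i j"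
  unfolding substc_def scale_right_distrib
  by (rule Sum_any.distrib) (rule substableD[OF assms(1)] substableD[OF assms(2)])+

lemma substc_diff:
  assumes "substable c P" "substable c Q"
  shows "substc c (\<lambda>i j. P i j - Q i j) i j = substc c P i j - substc c Q i j"
proof -
  have "substable c (\<lambda>i j. P i j - Q i j)"
    using substable_lincomb[OF assms, of "- 1"] by simp
  from substc_add[OF this assms(2)] show ?thesis by (simp add: eq_diff_eq)
qed

lemma Sum_any_reindex_int:
  "Sum_any (\<lambda>p::int. f (p - 1)) = (Sum_any f :: 'a)"
proof -
  have "bij (\<lambda>p::int. p - 1)" by (rule bij_betw_byWitness[of _ "\<lambda>p. p + 1"]) auto
  from Sum_any.reindex_cong[OF this, of f "\<lambda>p. f (p - 1)"] show ?thesis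
    by (simp add: o_def)
qed

text \<open>The property of the coefficients behind multiplication under a substitution;
  \<open>fwd\<close> and \<open>swp\<close> share it, so both are treated at once.\<close>

definition pascal :: "(int \<Rightarrow> int \<Rightarrow> 'k) \<Rightarrow> bool" where
  "pascal c \<longleftrightarrow> (\<forall>i p. c i p = c (i - 1) p + c i (p - 1))"

text \<open>Replacing \<open>z\<close> by \<open>y + x\<close> turns the factor \<open>z\<close>
  into \<open>y + x\<close>; the recursion of \<open>c\<close> splits each term accordingly.\<close>

lemma substc_shift_left:
  assumes "pascal c" "substable c P"
  shows "substc c (\<lambda>i j. P (i - 1) j) i j = substc c P (i - 1) j + substc c P i (j - 1)"
proof -
  let ?f = "\<lambda>p. scale (c i p) (P (i + p) (j - 1 - p))"
  have fin: "finite {p. ?f (p - 1) \<noteq> 0}"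
  proof (rule finite_subset)
    show "{p. ?f (p - 1) \<noteq> 0} \<subseteq> (\<lambda>p. p + 1) ` {p. ?f p \<noteq> 0}"
      by (force simp: image_iff)
  qed (intro finite_imageI substableD[OF assms(2)])
  have "substc c P (i - 1) j + substc c P i (j - 1) = substc c P (i - 1) j + Sum_any (\<lambda>p. ?f (p - 1))"
    unfolding Sum_any_reindex_int[of ?f] by (simp add: substc_def)
  also have "\<dots> = Sum_any (\<lambda>p. scale (c (i - 1) p) (P (i - 1 + p) (j - p)) + ?f (p - 1))"
    unfolding substc_def by (rule Sum_any.distrib[OF substableD[OF assms(2)] fin, symmetric])
  also have "(\<lambda>p. scale (c (i - 1) p) (P (i - 1 + p) (j - p)) + ?f (p - 1)) =
      (\<lambda>p. scale (c i p) (P (i + p - 1) (j - p)))"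
  proof
    fix p
    have c: "c i p = c (i - 1) p + c i (p - 1)"
      using assms(1) unfolding pascal_def by blast
    have eqs: "i - 1 + p = i + p - 1" "i + (p - 1) = i + p - 1" "j - 1 - (p - 1) = j - p"
      by simp_all
    show "scale (c (i - 1) p) (P (i - 1 + p) (j - p)) + ?f (p - 1) =
        scale (c i p) (P (i + p - 1) (j - p))"
      unfolding c eqs scale_left_distrib ..
  qed
  finally show ?thesis by (simp add: substc_def)
qed

text \<open>The substitution \<open>z = y + x\<close> turns multiplication by \<open>z - x\<close> into multiplication by \<open>y\<close>,
  and multiplication by \<open>z\<close> into multiplication by \<open>y + x\<close>.\<close>

lemma substc_binom_mult_minus:
  assumes "pascal c" "substable c P"
  shows "substc c (binom_mult scale (- 1) k P) i j = substc c P (i - int k) j"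
proof (induction k arbitrary: i j)
  case (Suc k)
  let ?Q = "binom_mult scale (- 1) k P"
  have Q: "substable c ?Q" by (rule substable_binom_mult[OF assms(2)])
  have "substc c (binom_mult scale (- 1) (Suc k) P) i j =
      substc c (\<lambda>i j. ?Q (i - 1) j - ?Q i (j - 1)) i j"
    by (simp add: binom_mult_Suc')
  also have "\<dots> = substc c (\<lambda>i j. ?Q (i - 1) j) i j - substc c (\<lambda>i j. ?Q i (j - 1)) i j"
    using substable_shift[OF Q, of 1 0] substable_shift[OF Q, of 0 1]
    by (intro substc_diff) simp_all
  also have "substc c (\<lambda>i j. ?Q i (j - 1)) i j = substc c ?Q i (j - 1)"
    by (simp add: substc_def algebra_simps)
  finally show ?case
    by (simp add: substc_shift_left[OF assms(1) Q] Suc.IH diff_diff_eq add.commute)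
qed simp

lemma binom_mult_plus_substc:
  assumes "pascal c" "substable c P"
  shows "binom_mult scale 1 n (substc c P) i j = substc c (\<lambda>i j. P (i - int n) j) i j"
proof (induction n arbitrary: i j)
  case (Suc n)
  have "substable c (\<lambda>i j. P (i - int n) j)"
    using substable_shift[OF assms(2), of "int n" 0] by simp
  from substc_shift_left[OF assms(1) this, of i j]
  have "binom_mult scale 1 (Suc n) (substc c P) i j = substc c (\<lambda>i j. P (i - 1 - int n) j) i j"
    by (simp add: binom_mult_Suc' Suc.IH)
  then show ?case by (simp add: diff_diff_eq)
qed simp

lemma pascal_fwd: "pascal fwd" and pascal_swp: "pascal swp"
  unfolding pascal_def using fwd_pascal swp_pascal by blast+

section \<open>Weak associativity, weak commutativity and the Jacobi identity\<close>

lemma binom_mult_swp_eq_0: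
  assumes "\<And>i j. i < - int n \<Longrightarrow> B i j = 0"
  shows "binom_mult scale 1 n (substc swp B) i j = 0"
proof -
  \<comment> \<open>Multiplying by \<open>(y + x)^n\<close> amounts to replacing \<open>B\<close> by
    \<open>z^n B\<close>, which has only nonnegative powers of \<open>z\<close>; on these both
    expansions agree.\<close>
  have "scale (swp i p) (B (i + p - int n) (j - p)) = 0" for p
    using assms swp_eq_0[of i p, where 'k = 'k] by (cases "0 \<le> i + p") auto
  then show ?thesis
    by (simp add: binom_mult_plus_substc[OF pascal_swp substable_swp[OF assms]] substc_def
        del: scale_eq_0_iff)
qed

lemma binom_mult_diff_swp:
  assumes "\<And>i j. i < - int n \<Longrightarrow> B i j = 0"
  shows "binom_mult scale 1 n (\<lambda>i j. P i j - substc swp B i j) = binom_mult scale 1 n P"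
  by (simp add: binom_mult_diff binom_mult_swp_eq_0[OF assms])

text \<open>Row \<open>i\<close> of \<open>E(y + x, x)\<close> involves only rows
  \<open>i' >= i\<close> of \<open>E\<close>. Those with \<open>i' >= 0\<close> drop out, as the
  polynomial \<open>(y + x)^i'\<close> has no negative powers of \<open>y\<close>.\<close>

lemma substc_fwd_neg:
  assumes "i < 0" and "\<And>i' j. i < i' \<Longrightarrow> i' < 0 \<Longrightarrow> E i' j = 0"
  shows "substc fwd E i j = E i j"
proof -
  have "scale (fwd i p) (E (i + p) (j - p)) = (if p = 0 then E i j else 0)" for p
    using assms fwd_eq_0[of i p, where 'k = 'k]
    by (cases "0 \<le> i + p"; cases "p < 0") (auto simp: fwd_def)
  then show ?thesis by (simp add: substc_def)
qed

text \<open>The bounds \<open>p\<close> and \<open>q\<close> make the two substitutions finite sums,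
  while \<open>r\<close> and \<open>k\<close> bound the difference of the two sides below in
  \<open>y\<close>.\<close>

lemma associator_eq:
  assumes A: "\<And>i j. j < p \<Longrightarrow> A i j = 0"
    and B: "\<And>i j. i < q \<Longrightarrow> B i j = 0"
    and C: "\<And>i j. i < r \<Longrightarrow> C i j = 0"
    and assoc: "binom_mult scale 1 n (substc fwd A) = binom_mult scale 1 n C"
    and comm: "binom_mult scale (- 1) k A = binom_mult scale (- 1) k B"
  shows "C i j = substc fwd A i j - substc swp B i j"
proof -
  have sA: "substable fwd A" by (rule substable_fwd[of p A]) (rule A)
  have sB: "substable swp B" by (rule substable_swp[of q B]) (rule B)
  let ?X = "\<lambda>i j. substc fwd A i j - substc swp B i j - C i j"
  \<comment> \<open>Enlarged by a bound on the pole order of \<open>B\<close> in \<open>z\<close>,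
    so that the power also kills the bracket.\<close>
  define n' where "n' = n + nat (- q)"
  have n': "binom_mult scale 1 n' (substc fwd A) = binom_mult scale 1 n' C"
  proof -
    have "binom_mult scale 1 (n + m) (substc fwd A) = binom_mult scale 1 (n + m) C" for m
      by (induction m) (simp_all add: assoc binom_mult_Suc')
    then show ?thesis by (simp add: n'_def)
  qed
  have "B i j = 0" if "i < - int n'" for i j
    using that unfolding n'_def by (intro B) linarith
  then have kill: "binom_mult scale 1 n' ?X i j = 0" for i j
    by (simp add: binom_mult_diff binom_mult_swp_eq_0 n')
  have low: "?X i j = 0" if "i < min r (- int k)" for i j
  proof -
    \<comment> \<open>Substitution turns \<open>(z - x)^k\<close> into \<open>y^k\<close>. At
      \<open>i + k < 0\<close> the coefficients \<open>fwd\<close> and \<open>swp\<close> coincide,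
      so weak commutativity exchanges \<open>A\<close> for \<open>B\<close>.\<close>
    have "substc fwd A i j = substc fwd (binom_mult scale (- 1) k A) (i + int k) j"
      by (simp add: substc_binom_mult_minus[OF pascal_fwd sA])
    also have "\<dots> = substc swp (binom_mult scale (- 1) k B) (i + int k) j"
      using that by (simp add: comm substc_def swp_eq_fwd)
    also have "\<dots> = substc swp B i j"
      by (simp add: substc_binom_mult_minus[OF pascal_swp sB])
    finally show ?thesis using that C by simp
  qed
  have "?X i j = 0"
    by (rule binom_mult_cancel[where m = "min r (- int k)", OF _ low kill]) simp_all
  then show ?thesis by simp
qed

text \<open>For \<open>i < 0\<close> the triangular system \<open>substc_fwd_neg\<close> shows that \<open>(z - x)\<^sup>K (A - B)\<close> has no terms
  with negative powers of \<open>z\<close>; being killed by a power of \<open>z - x\<close>, it vanishes.\<close>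

lemma commutator_eq:
  assumes A: "\<And>i j. j < p \<Longrightarrow> A i j = 0"
    and B: "\<And>i j. i < q \<Longrightarrow> B i j = 0"
    and C: "\<And>i j. i < - int K \<Longrightarrow> C i j = 0"
    and C_eq: "\<And>i j. C i j = substc fwd A i j - substc swp B i j"
    and comm: "binom_mult scale (- 1) k A = binom_mult scale (- 1) k B"
  shows "binom_mult scale (- 1) K A = binom_mult scale (- 1) K B"
proof -
  let ?A = "binom_mult scale (- 1) K A" and ?B = "binom_mult scale (- 1) K B"
  have sA: "substable fwd A" by (rule substable_fwd[of p A]) (rule A)
  have sB: "substable swp B" by (rule substable_swp[of q B]) (rule B)
  define E where "E = (\<lambda>i j. ?A i j - ?B i j)"
  have E_neg: "E i j = 0" if "i < 0" for i j
    using that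
  proof (induction "nat (- i)" arbitrary: i j rule: less_induct)
    case less
    have finA: "finite {p. scale (fwd i p) (?A (i + p) (j - p)) \<noteq> 0}"
      by (rule substableD[OF substable_binom_mult[OF sA]])
    \<comment> \<open>\<open>B\<close> is bounded in \<open>z\<close> only, so finiteness of its
      \<open>fwd\<close> expansion is taken from \<open>swp\<close>, which has the same coefficients
      for negative \<open>i\<close>.\<close>
    have finB: "finite {p. scale (fwd i p) (?B (i + p) (j - p)) \<noteq> 0}"
      using substableD[OF substable_binom_mult[where \<epsilon> = "- 1" and l = K, OF sB], of i i j] less.prems
      by (simp add: swp_eq_fwd)
    have "substc fwd ?A i j - substc swp ?B i j = C (i - int K) j"
      by (simp add: C_eq substc_binom_mult_minus[OF pascal_fwd sA]
        substc_binom_mult_minus[OF pascal_swp sB])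
    \<comment> \<open>The coefficient of \<open>C\<close> at \<open>y^(i-K)\<close> is zero by the
      pole bound, since \<open>i < 0\<close>.\<close>
    then have "substc fwd ?A i j = substc fwd ?B i j"
      using less.prems C by (simp add: substc_def swp_eq_fwd)
    moreover have "substc fwd ?A i j = substc fwd E i j + substc fwd ?B i j"
    proof -
      have "finite {p. scale (fwd i p) (E (i + p) (j - p)) \<noteq> 0}"
        by (rule finite_subset[OF _ finite_UnI[OF finA finB]]) (auto simp: E_def)
      from Sum_any.distrib[OF this finB] show ?thesis
        by (simp add: substc_def E_def scale_right_diff_distrib)
    qed
    ultimately have "substc fwd E i j = 0" by simp
    moreover have "substc fwd E i j = E i j"
      using less by (intro substc_fwd_neg) auto
    ultimately show ?case by simp
  qed
  have "binom_mult scale (- 1) k E i j = 0" for i j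
  proof -
    \<comment> \<open>Commuting the two powers lets the hypothesis with exponent \<open>k\<close>
      apply first.\<close>
    have swap: "binom_mult scale (- 1) k (binom_mult scale (- 1) K P) =
        binom_mult scale (- 1) K (binom_mult scale (- 1) k P)" for P
      by (induction k)
        (simp_all add: binom_mult_Suc' binom_mult_step[where \<epsilon> = "- 1", simplified])
    show ?thesis by (simp add: E_def binom_mult_diff swap comm)
  qed
  then have "E i j = 0" for i j
    by (intro binom_mult_cancel[OF _ E_neg]) auto
  then show ?thesis by (simp add: E_def fun_eq_iff)
qed

text \<open>Links the natural summation index of \<open>shifted_op\<close> to the integer index of
  \<open>substc\<close>, where \<open>fwd\<close> is zero at negative \<open>p\<close>.\<close>

lemma Sum_any_fwd:
  "Sum_any (\<lambda>k::nat. scale (of_int (i + int k) gchoose k) (P (i + int k) (j - int k))) =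
   substc fwd P i j"
proof -
  let ?g = "\<lambda>p. scale (fwd i p) (P (i + p) (j - p))"
  have "{p. ?g p \<noteq> 0} = int ` {k. ?g (int k) \<noteq> 0}"
  proof (intro equalityI subsetI)
    fix p assume "p \<in> {p. ?g p \<noteq> 0}"
    then show "p \<in> int ` {k. ?g (int k) \<noteq> 0}"
      by (intro image_eqI[of _ _ "nat p"]) (auto simp: fwd_def split: if_splits)
  qed auto
  then have "Sum_any ?g = Sum_any (\<lambda>k. ?g (int k))"
    unfolding Sum_any.expand_set by (simp add: sum.reindex o_def)
  then show ?thesis by (simp add: substc_def fwd_def)
qed

end

text \<open>Additivity holds only on \<open>S\<close>, so membership of the partial sums is carried
  along the induction.\<close>

lemma additive_Sum_any:
  assumes "f 0 = (0::'b::ab_group_add)"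
    and "\<And>x y. x \<in> S \<Longrightarrow> y \<in> S \<Longrightarrow> f (x + y) = f x + f y"
    and "0 \<in> S" "\<And>x y. x \<in> S \<Longrightarrow> y \<in> S \<Longrightarrow> x + y \<in> S"
    and "\<And>k. g k \<in> S" and fin: "finite {k. g k \<noteq> (0::'a::ab_group_add)}"
  shows "f (Sum_any g) = Sum_any (\<lambda>k. f (g k))" "Sum_any g \<in> S"
proof -
  have *: "f (sum g K) = (\<Sum>k\<in>K. f (g k)) \<and> sum g K \<in> S" if "finite K" for K
    using that by induction (simp_all add: assms)
  have "Sum_any (\<lambda>k. f (g k)) = (\<Sum>k\<in>{k. g k \<noteq> 0}. f (g k))"
    by (rule Sum_any.expand_superset[OF fin]) (auto simp: assms(1))
  then show "f (Sum_any g) = Sum_any (\<lambda>k. f (g k))" "Sum_any g \<in> S"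
    using *[OF fin] by (simp_all add: Sum_any.expand_set[of g])
qed

section \<open>Vertex bilinear maps as homomorphisms into Vhom\<close>

lemma vertex_module_char_0:
  "vertex_module V M \<Longrightarrow> char_0_vector_space (scl M)"
  by (simp add: vertex_module_def vspace_on_def char_0_vector_space_def)

lemma vertex_module_subspace:
  assumes "vertex_module V M"
  shows "0 \<in> carr M" "x \<in> carr M \<Longrightarrow> y \<in> carr M \<Longrightarrow> x + y \<in> carr M"
    "x \<in> carr M \<Longrightarrow> scl M c x \<in> carr M"
proof -
  interpret char_0_vector_space "scl M" by (rule vertex_module_char_0[OF assms])
  have "subspace (carr M)" using assms by (simp add: vertex_module_def vspace_on_def)
  then show "0 \<in> carr M" "x \<in> carr M \<Longrightarrow> y \<in> carr M \<Longrightarrow> x + y \<in> carr M"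
    "x \<in> carr M \<Longrightarrow> scl M c x \<in> carr M"
    by (auto simp: subspace_def)
qed

lemma vertex_module_der: "vertex_module V M \<Longrightarrow> u \<in> carr M \<Longrightarrow> der M u \<in> carr M"
  by (auto simp: vertex_module_def)

lemma vertex_module_vop:
  assumes "vertex_module V M" "a \<in> carr V" "u \<in> carr M"
  shows "vop M a u i \<in> carr M"
  using assms unfolding vertex_module_def laurent_def by blast

lemma vertex_module_vop_bound:
  assumes "vertex_module V M" "a \<in> carr V" "u \<in> carr M"
  obtains k where "\<And>i. i < - int k \<Longrightarrow> vop M a u i = 0"
proof -
  obtain n where n: "\<And>i. i < n \<Longrightarrow> vop M a u i = 0"
    using assms unfolding vertex_module_def laurent_def by blast
  have "i < n" if "i < - int (nat (- n))" for i using that by linarith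
  then show ?thesis by (rule that[OF n])
qed

lemma linear_on_0:
  assumes "linear_on s S t f" "(0::'a::ab_group_add) \<in> S"
  shows "f 0 = (0::'b::ab_group_add)"
proof -
  have "f (0 + 0) = f 0 + f 0" using assms unfolding linear_on_def by blast
  then show ?thesis by simp
qed

lemma vertex_module_vop_0:
  assumes "vertex_module V M" "a \<in> carr V"
  shows "vop M a 0 = 0"
  using assms vertex_module_subspace(1)[OF assms(1)] unfolding vertex_module_def
  by (blast intro: linear_on_0)

lemma shifted_op_eq:
  assumes "char_0_vector_space (scl W)"
  shows "shifted_op W a g =
    char_0_vector_space.substc (scl W) fwd (\<lambda>i j. vop W a (g j) i)"
proof -
  interpret char_0_vector_space "scl W" by fact
  show ?thesis by (intro ext) (simp add: shifted_op_def flip: Sum_any_fwd)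
qed

lemma swap_diff_eq:
  assumes "char_0_vector_space (scl N)"
  shows "swap_diff N a v i p = scl N (swp i p) (vop N a v (i + p))"
proof -
  interpret char_0_vector_space "scl N" by fact
  show ?thesis
    by (simp add: swap_diff_def swp_def fwd_def scale_left_diff_distrib add.commute[of p i])
qed

text \<open>Linearity of \<open>f\<close> pulls the scalars \<open>swp i p\<close> out of
  \<open>swap_diff\<close>, which turns the sum in the definition into a substitution.\<close>

lemma Vhom_vop_eq:
  assumes "vertex_module V N" "vertex_module V W"
    and "linear_on (scl N) (carr N) (pointwise (scl W)) f" "a \<in> carr V" "v \<in> carr N"
  shows "vop (Vhom V N W) a f i v j =
    char_0_vector_space.substc (scl W) fwd (\<lambda>i j. vop W a (f v j) i) i j -
    char_0_vector_space.substc (scl W) swp (\<lambda>i j. f (vop N a v i) j) i j"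
proof -
  interpret char_0_vector_space "scl W" by (rule vertex_module_char_0[OF assms(2)])
  have "f (swap_diff N a v i p) (j - p) = scl W (swp i p) (f (vop N a v (i + p)) (j - p))" for p
    using assms(3) vertex_module_vop[OF assms(1,4,5)]
    by (simp add: swap_diff_eq[OF vertex_module_char_0[OF assms(1)]] linear_on_def pointwise_def)
  then show ?thesis
    using assms(5) by (simp add: Vhom_def shifted_op_eq[OF vertex_module_char_0[OF assms(2)]] substc_def)
qed

lemma laurent_bound:
  assumes "g \<in> laurent S"
  obtains m where "\<And>j. j < m \<Longrightarrow> g j = 0"
  using assms unfolding laurent_def by blast

text \<open>Weak commutativity is part of the membership of \<open>F u\<close> in
  \<open>Vhom\<close>; weak associativity has to be extracted from compatibility with
  \<open>a\<close>.\<close>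

lemma Hom_Vhom_vertex_bilinear:
  assumes M: "vertex_module V M" and N: "vertex_module V N" and W: "vertex_module V W"
    and F: "F \<in> Hom V M (Vhom V N W)"
  shows "vertex_bilinear V M N W F"
proof -
  interpret char_0_vector_space "scl W" by (rule vertex_module_char_0[OF W])
  have Fu: "F u \<in> carr (Vhom V N W)" if "u \<in> carr M" for u
    using F that by (auto simp: Hom_def)
  have lin: "linear_on (scl N) (carr N) (pointwise (scl W)) (F u)" if "u \<in> carr M" for u
    using Fu[OF that] by (simp add: Vhom_def)
  have assoc: "\<exists>n. binom_mult (scl W) 1 n (shifted_op W a (F u v)) =
        binom_mult (scl W) 1 n (\<lambda>i j. F (vop M a u i) v j)"
    if a: "a \<in> carr V" and u: "u \<in> carr M" and v: "v \<in> carr N" for a u v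
  proof -
    \<comment> \<open>A pole order of \<open>a\<close> on \<open>v\<close> serves as exponent, since
      it bounds \<open>F u (vop N a v i)\<close> in \<open>i\<close>.\<close>
    obtain n where n: "\<And>i. i < - int n \<Longrightarrow> vop N a v i = 0"
      by (rule vertex_module_vop_bound[OF N a v]) blast
    have "F (vop M a u i) v j = substc fwd (\<lambda>i j. vop W a (F u v j) i) i j -
        substc swp (\<lambda>i j. F u (vop N a v i) j) i j" for i j
      using F a u Vhom_vop_eq[OF N W lin[OF u] a v] by (simp add: Hom_def)
    moreover have "F u (vop N a v i) j = 0" if "i < - int n" for i j
      using n[OF that] linear_on_0[OF lin[OF u] vertex_module_subspace(1)[OF N]] by simp
    then have "binom_mult (scl W) 1 n (\<lambda>i j. P i j - substc swp (\<lambda>i j. F u (vop N a v i) j) i j) =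
        binom_mult (scl W) 1 n P" for P
      by (rule binom_mult_diff_swp)
    ultimately show ?thesis
      by (intro exI[of _ n]) (simp add: shifted_op_eq[OF vertex_module_char_0[OF W]])
  qed
  show ?thesis
    unfolding vertex_bilinear_def
  proof (intro conjI ballI allI)
    fix u v assume u: "u \<in> carr M" and v: "v \<in> carr N"
    show "F u v \<in> laurent (carr W)" using Fu[OF u] v by (simp add: Vhom_def)
    show "F (der M u) v = ddz (scl W) (F u v)" using F u by (simp add: Hom_def Vhom_def)
    show "F u (der N v) i = der W (F u v i) - ddz (scl W) (F u v) i" for i
      using Fu[OF u] v by (simp add: Vhom_def)
    fix a assume a: "a \<in> carr V"
    have "\<exists>k. binom_mult (scl W) (- 1) k (\<lambda>i j. vop W a (F u v j) i) =
        binom_mult (scl W) (- 1) k (\<lambda>i j. F u (vop N a v i) j)"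
      using Fu[OF u] v a unfolding Vhom_def by simp blast
    with assoc[OF a u v] show "\<exists>n k.
        binom_mult (scl W) 1 n (shifted_op W a (F u v)) =
        binom_mult (scl W) 1 n (\<lambda>i j. F (vop M a u i) v j) \<and>
        binom_mult (scl W) (- 1) k (\<lambda>i j. vop W a (F u v j) i) =
        binom_mult (scl W) (- 1) k (\<lambda>i j. F u (vop N a v i) j)" by blast
  next
    fix u assume "u \<in> carr M"
    then show "linear_on (scl N) (carr N) (pointwise (scl W)) (F u)" by (rule lin)
  next
    fix v assume "v \<in> carr N"
    show "linear_on (scl M) (carr M) (pointwise (scl W)) (\<lambda>u. F u v)"
      using F by (simp add: Hom_def linear_on_def Vhom_def pointwise_def)
  qed
qed

text \<open>Elements of both \<open>Hom\<close> and \<open>Vhom\<close> are extended by zero, hence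
  the condition \<open>outside\<close>.\<close>

lemma vertex_bilinear_in_Hom:
  assumes M: "vertex_module V M" and N: "vertex_module V N" and W: "vertex_module V W"
    and F: "vertex_bilinear V M N W F"
    and outside: "\<And>u v. u \<notin> carr M \<or> v \<notin> carr N \<Longrightarrow> F u v = 0"
  shows "F \<in> Hom V M (Vhom V N W)"
proof -
  interpret char_0_vector_space "scl W" by (rule vertex_module_char_0[OF W])
  have lau: "F u v \<in> laurent (carr W)" if "u \<in> carr M" "v \<in> carr N" for u v
    using F that by (simp add: vertex_bilinear_def)
  have lin: "linear_on (scl N) (carr N) (pointwise (scl W)) (F u)" if "u \<in> carr M" for u
    using F that by (simp add: vertex_bilinear_def)
  have lin': "linear_on (scl M) (carr M) (pointwise (scl W)) (\<lambda>u. F u v)" if "v \<in> carr N" for v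
    using F that by (simp add: vertex_bilinear_def)
  have F0: "F 0 v = 0" if "v \<in> carr N" for v
    using linear_on_0[OF lin'[OF that] vertex_module_subspace(1)[OF M]] .
  have F0': "F u 0 = 0" if "u \<in> carr M" for u
    using linear_on_0[OF lin[OF that] vertex_module_subspace(1)[OF N]] .
  have key: "F (vop M a u i) v j = substc fwd (\<lambda>i j. vop W a (F u v j) i) i j -
          substc swp (\<lambda>i j. F u (vop N a v i) j) i j"
      "binom_mult (scl W) (- 1) K (\<lambda>i j. vop W a (F u v j) i) =
        binom_mult (scl W) (- 1) K (\<lambda>i j. F u (vop N a v i) j)"
    if a: "a \<in> carr V" and u: "u \<in> carr M" and v: "v \<in> carr N"
      and K: "\<And>i. i < - int K \<Longrightarrow> vop M a u i = 0" for a u v K i j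
  proof -
    let ?A = "\<lambda>i j. vop W a (F u v j) i" and ?B = "\<lambda>i j. F u (vop N a v i) j"
      and ?C = "\<lambda>i j. F (vop M a u i) v j"
    obtain n k where nk: "binom_mult (scl W) 1 n (substc fwd ?A) = binom_mult (scl W) 1 n ?C"
      "binom_mult (scl W) (- 1) k ?A = binom_mult (scl W) (- 1) k ?B"
      using F a u v unfolding vertex_bilinear_def shifted_op_eq[OF vertex_module_char_0[OF W]]
      by meson
    obtain p where "\<And>j. j < p \<Longrightarrow> F u v j = 0" by (rule laurent_bound[OF lau[OF u v]]) blast
    then have A: "?A i j = 0" if "j < p" for i j
      using that by (simp add: vertex_module_vop_0[OF W a])
    obtain q where "\<And>i. i < - int q \<Longrightarrow> vop N a v i = 0"
      by (rule vertex_module_vop_bound[OF N a v]) blast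
    then have B: "?B i j = 0" if "i < - int q" for i j
      using that by (simp add: F0'[OF u])
    have C: "?C i j = 0" if "i < - int K" for i j
      using that by (simp add: F0[OF v] K)
    show eq: "?C i j = substc fwd ?A i j - substc swp ?B i j" for i j
      by (rule associator_eq[OF A B C nk])
    show "binom_mult (scl W) (- 1) K ?A = binom_mult (scl W) (- 1) K ?B"
      by (rule commutator_eq[OF A B C eq nk(2)])
  qed
  have Fu: "F u \<in> carr (Vhom V N W)" if u: "u \<in> carr M" for u
  proof -
    have "\<exists>k. \<forall>v\<in>carr N. binom_mult (scl W) (- 1) k (\<lambda>i j. vop W a (F u v j) i) =
        binom_mult (scl W) (- 1) k (\<lambda>i j. F u (vop N a v i) j)" if a: "a \<in> carr V" for a
    proof -
      \<comment> \<open>Chosen before \<open>v\<close>, hence uniform in \<open>v\<close>.\<close>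
      obtain K where "\<And>i. i < - int K \<Longrightarrow> vop M a u i = 0"
        by (rule vertex_module_vop_bound[OF M a u]) blast
      from key(2)[OF a u _ this] show ?thesis by blast
    qed
    then show ?thesis
      using F u lau lin by (simp add: Vhom_def vertex_bilinear_def outside)
  qed
  have vop: "F (vop M a u i) = vop (Vhom V N W) a (F u) i"
    if a: "a \<in> carr V" and u: "u \<in> carr M" for a u i
  proof (rule ext, rule ext)
    fix v j
    show "F (vop M a u i) v j = vop (Vhom V N W) a (F u) i v j"
    proof (cases "v \<in> carr N")
      case True
      obtain K where "\<And>i. i < - int K \<Longrightarrow> vop M a u i = 0"
        by (rule vertex_module_vop_bound[OF M a u]) blast
      from key(1)[OF a u True this] show ?thesis
        using Vhom_vop_eq[OF N W lin[OF u] a True] by simp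
    qed (simp add: outside Vhom_def)
  qed
  have der: "F (der M u) = der (Vhom V N W) (F u)" if u: "u \<in> carr M" for u
  proof
    fix v
    show "F (der M u) v = der (Vhom V N W) (F u) v"
      using F u by (cases "v \<in> carr N")
        (auto simp: Vhom_def vertex_bilinear_def outside ddz_def fun_eq_iff)
  qed
  have "linear_on (scl M) (carr M) (scl (Vhom V N W)) F"
    unfolding linear_on_def
  proof (intro conjI ballI allI; rule ext; rule ext)
    fix x y v j assume "x \<in> carr M" "y \<in> carr M"
    then show "F (x + y) v j = (F x + F y) v j"
      using lin'[of v] by (cases "v \<in> carr N") (auto simp: linear_on_def outside)
  next
    fix c x v j assume "x \<in> carr M"
    then show "F (scl M c x) v j = scl (Vhom V N W) c (F x) v j"
      using lin'[of v]
      by (cases "v \<in> carr N") (auto simp: linear_on_def outside Vhom_def pointwise_def)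
  qed
  then show ?thesis
    using Fu vop der by (auto simp: Hom_def outside fun_eq_iff)
qed

section \<open>Composition with homomorphisms\<close>

lemma Hom_0:
  assumes "\<phi> \<in> Hom V M N" "vertex_module V M"
  shows "\<phi> 0 = 0"
  using assms(1) vertex_module_subspace(1)[OF assms(2)] unfolding Hom_def
  by (blast intro: linear_on_0)

text \<open>\<open>g 0 = 0\<close> keeps the composite zero off the carrier of
  \<open>L\<close>.\<close>

lemma Hom_comp:
  assumes "f \<in> Hom V L M" "g \<in> Hom V M N" "vertex_module V M"
  shows "g \<circ> f \<in> Hom V L N"
  using assms(1,2) Hom_0[OF assms(2,3)]
  by (auto simp: Hom_def linear_on_def Pi_iff)

lemma id_hom_in_Hom:
  assumes "vertex_module V M"
  shows "id_hom M \<in> Hom V M M"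
  using vertex_module_subspace[OF assms] vertex_module_der[OF assms] vertex_module_vop[OF assms]
  by (auto simp: Hom_def linear_on_def id_hom_def)

section \<open>The vector space of homomorphisms\<close>

lemma vertex_module_vop_lin:
  assumes "vertex_module V M" "a \<in> carr V"
  shows "x \<in> carr M \<Longrightarrow> y \<in> carr M \<Longrightarrow> vop M a (x + y) i = vop M a x i + vop M a y i"
    "x \<in> carr M \<Longrightarrow> vop M a (scl M c x) i = scl M c (vop M a x i)"
proof -
  have "linear_on (scl M) (carr M) (pointwise (scl M)) (vop M a)"
    using assms unfolding vertex_module_def by blast
  then show "x \<in> carr M \<Longrightarrow> y \<in> carr M \<Longrightarrow> vop M a (x + y) i = vop M a x i + vop M a y i"
    "x \<in> carr M \<Longrightarrow> vop M a (scl M c x) i = scl M c (vop M a x i)"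
    by (simp_all add: linear_on_def pointwise_def)
qed

lemma vertex_module_der_lin:
  assumes "vertex_module V M"
  shows "x \<in> carr M \<Longrightarrow> y \<in> carr M \<Longrightarrow> der M (x + y) = der M x + der M y"
    "x \<in> carr M \<Longrightarrow> der M (scl M c x) = scl M c (der M x)"
  using assms by (simp_all add: vertex_module_def linear_on_def)

lemma vector_space_pointwise:
  assumes "vector_space (s :: 'k::field \<Rightarrow> 'b::ab_group_add \<Rightarrow> 'b)"
  shows "vector_space (pointwise s :: 'k \<Rightarrow> ('a \<Rightarrow> 'b) \<Rightarrow> 'a \<Rightarrow> 'b)"
proof -
  interpret vector_space s by fact
  show ?thesis
    by unfold_locales
      (simp_all add: pointwise_def fun_eq_iff scale_right_distrib scale_left_distrib)
qed

lemma vspace_on_Hom: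
  assumes M: "vertex_module V M" and N: "vertex_module V N"
  shows "vspace_on (pointwise (scl N)) (Hom V M N)"
proof -
  interpret N: char_0_vector_space "scl N" by (rule vertex_module_char_0[OF N])
  interpret M: char_0_vector_space "scl M" by (rule vertex_module_char_0[OF M])
  interpret H: vector_space "pointwise (scl N) :: _ \<Rightarrow> ('c \<Rightarrow> 'd) \<Rightarrow> _"
    by (rule vector_space_pointwise) unfold_locales
  note simps = Hom_def linear_on_def Pi_iff vertex_module_subspace[OF N]
    vertex_module_vop_lin[OF N] vertex_module_der_lin[OF N] pointwise_def
  have "der N 0 = 0"
    using vertex_module_der_lin(2)[OF N vertex_module_subspace(1)[OF N], of 0] by simp
  then have "0 \<in> Hom V M N"
    by (simp add: simps vertex_module_vop_0[OF N])
  moreover have "f + g \<in> Hom V M N" if "f \<in> Hom V M N" "g \<in> Hom V M N" for f g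
    using that by (simp add: simps N.scale_right_distrib algebra_simps)
  moreover have "pointwise (scl N) c f \<in> Hom V M N" if "f \<in> Hom V M N" for c f
    using that by (simp add: simps N.scale_right_distrib mult.commute)
  ultimately show ?thesis
    unfolding vspace_on_def H.subspace_def using H.vector_space_axioms by blast
qed

text \<open>Being the image of a subspace under a linear map, the target is a subspace. This yields
  the vector space structure on the homomorphisms into \<open>Vhom V N W\<close>.\<close>

lemma vspace_iso_bij:
  assumes S: "vspace_on s S" and t: "vector_space t"
    and lin: "linear_on s S t f" and bij: "bij_betw f S T"
  shows "vspace_iso s S t T f"
proof -
  interpret s: vector_space s using S by (simp add: vspace_on_def)
  interpret t: vector_space t by (rule t)
  have sub: "s.subspace S" using S by (simp add: vspace_on_def)
  have im: "T = f ` S" using bij by (simp add: bij_betw_def)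
  have "t.subspace T"
    unfolding t.subspace_def im
  proof (intro conjI ballI allI)
    show "0 \<in> f ` S"
      using linear_on_0[OF lin s.subspace_0[OF sub]] s.subspace_0[OF sub] by (metis image_eqI)
    show "x + y \<in> f ` S" if "x \<in> f ` S" "y \<in> f ` S" for x y
      using that lin s.subspace_add[OF sub] unfolding linear_on_def by (smt (verit) image_iff)
    show "t c x \<in> f ` S" if "x \<in> f ` S" for c x
      using that lin s.subspace_scale[OF sub] unfolding linear_on_def by (smt (verit) image_iff)
  qed
  then show ?thesis using assms by (simp add: vspace_iso_def vspace_on_def)
qed

section \<open>Pullback and pushforward of vertex bilinear maps\<close>

lemma vertex_bilinear_pull:
  assumes f: "f \<in> Hom V M M'" and g: "g \<in> Hom V N N'"
    and F: "vertex_bilinear V M' N' W F"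
  shows "vertex_bilinear V M N W (\<lambda>u v. F (f u) (g v))"
proof -
  have fs: "f u \<in> carr M'" "f (der M u) = der M' (f u)" if "u \<in> carr M" for u
    using f that by (auto simp: Hom_def)
  have gs: "g v \<in> carr N'" "g (der N v) = der N' (g v)" if "v \<in> carr N" for v
    using g that by (auto simp: Hom_def)
  have fv: "f (vop M a u i) = vop M' a (f u) i" if "a \<in> carr V" "u \<in> carr M" for a u i
    using f that by (auto simp: Hom_def)
  have gv: "g (vop N a v i) = vop N' a (g v) i" if "a \<in> carr V" "v \<in> carr N" for a v i
    using g that by (auto simp: Hom_def)
  have fl: "linear_on (scl M) (carr M) (scl M') f" and gl: "linear_on (scl N) (carr N) (scl N') g"
    using f g by (auto simp: Hom_def)
  show ?thesis
    using F fl gl unfolding vertex_bilinear_def linear_on_def by (simp add: fs gs fv gv)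
qed

lemma Hom_binom_mult:
  assumes T: "vertex_module V T" and f: "f \<in> Hom V T W" and P: "\<And>i j. P i j \<in> carr T"
  shows "f (binom_mult (scl T) \<epsilon> n P i j) = binom_mult (scl W) \<epsilon> n (\<lambda>i j. f (P i j)) i j"
proof -
  have "f (sum g K) = (\<Sum>k\<in>K. f (g k)) \<and> sum g K \<in> carr T"
    if "finite K" "\<And>k. g k \<in> carr T" for g and K :: "nat set"
    using that f
    by induction (simp_all add: Hom_0[OF f T] vertex_module_subspace[OF T] Hom_def linear_on_def)
  moreover have "f (scl T c (P i j)) = scl W c (f (P i j))" for c i j
    using f P by (simp add: Hom_def linear_on_def)
  ultimately show ?thesis
    by (simp add: binom_mult_def P vertex_module_subspace[OF T])
qed

text \<open>The sum is finite because \<open>g\<close> is a Laurent series, so \<open>f\<close>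
  passes through it. Membership in the carrier is what allows \<open>f\<close> to be applied to weak
  associativity.\<close>

lemma Hom_shifted_op:
  assumes T: "vertex_module V T" and f: "f \<in> Hom V T W" and a: "a \<in> carr V"
    and g: "g \<in> laurent (carr T)"
  shows "f (shifted_op T a g i j) = shifted_op W a (\<lambda>n. f (g n)) i j"
    and "shifted_op T a g i j \<in> carr T"
proof -
  interpret T: char_0_vector_space "scl T" by (rule vertex_module_char_0[OF T])
  let ?h = "\<lambda>k. scl T (of_int (i + int k) gchoose k) (vop T a (g (j - int k)) (i + int k))"
  have gc: "g n \<in> carr T" for n using g by (simp add: laurent_def)
  have hc: "?h k \<in> carr T" for k
    by (intro vertex_module_subspace(3)[OF T] vertex_module_vop[OF T a] gc)
  obtain m where m: "\<And>n. n < m \<Longrightarrow> g n = 0" by (rule laurent_bound[OF g]) blast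
  have "finite {k. ?h k \<noteq> 0}"
  proof (rule finite_subset)
    show "{k. ?h k \<noteq> 0} \<subseteq> {..nat (j - m)}"
    proof
      fix k assume k: "k \<in> {k. ?h k \<noteq> 0}"
      have "\<not> j - int k < m"
      proof
        assume "j - int k < m"
        then have "?h k = 0" by (simp add: m vertex_module_vop_0[OF T a])
        then show False using k by simp
      qed
      then show "k \<in> {..nat (j - m)}" by simp
    qed
  qed simp
  note * = additive_Sum_any[where f = f and S = "carr T" and g = ?h,
      OF Hom_0[OF f T] _ vertex_module_subspace(1,2)[OF T] hc this]
  have add: "f (x + y) = f x + f y" if "x \<in> carr T" "y \<in> carr T" for x y
    using f that by (simp add: Hom_def linear_on_def)
  have "f (?h k) = scl W (of_int (i + int k) gchoose k) (vop W a (f (g (j - int k))) (i + int k))" for k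
    using f gc a vertex_module_vop[OF T a gc] by (simp add: Hom_def linear_on_def)
  then show "f (shifted_op T a g i j) = shifted_op W a (\<lambda>n. f (g n)) i j"
    using *(1) add by (simp add: shifted_op_def)
  show "shifted_op T a g i j \<in> carr T"
    using *(2) add by (simp add: shifted_op_def)
qed

text \<open>A homomorphism commutes with every operation in the axioms, so the same exponents serve
  again.\<close>

lemma vertex_bilinear_push:
  assumes M: "vertex_module V M" and N: "vertex_module V N" and T: "vertex_module V T"
    and f: "f \<in> Hom V T W" and F: "vertex_bilinear V M N T F"
  shows "vertex_bilinear V M N W (\<lambda>u v i. f (F u v i))"
proof -
  have lau: "F u v \<in> laurent (carr T)" if "u \<in> carr M" "v \<in> carr N" for u v
    using F that by (simp add: vertex_bilinear_def)
  have Fc: "F u v i \<in> carr T" if "u \<in> carr M" "v \<in> carr N" for u v i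
    using lau[OF that] by (simp add: laurent_def)
  have fc: "f x \<in> carr W" if "x \<in> carr T" for x
    using f that by (auto simp: Hom_def)
  have fadd: "f (x + y) = f x + f y" if "x \<in> carr T" "y \<in> carr T" for x y
    using f that by (auto simp: Hom_def linear_on_def)
  have fscl: "f (scl T c x) = scl W c (f x)" if "x \<in> carr T" for x c
    using f that by (auto simp: Hom_def linear_on_def)
  have fder: "f (der T x) = der W (f x)" if "x \<in> carr T" for x
    using f that by (auto simp: Hom_def)
  have fvop: "vop W a (f x) i = f (vop T a x i)" if "a \<in> carr V" "x \<in> carr T" for a x i
    using f that by (auto simp: Hom_def)
  have fdiff: "f (x - y) = f x - f y" if "x \<in> carr T" "y \<in> carr T" for x y
  proof -
    interpret T: char_0_vector_space "scl T" by (rule vertex_module_char_0[OF T])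
    have "x - y \<in> carr T"
      using vertex_module_subspace(2)[OF T that(1) vertex_module_subspace(3)[OF T that(2), of "- 1"]]
      by simp
    from fadd[OF this that(2)] show ?thesis by simp
  qed
  have fbinom: "binom_mult (scl W) \<epsilon> n (\<lambda>i j. f (P i j)) = binom_mult (scl W) \<epsilon> n (\<lambda>i j. f (Q i j))"
    if "binom_mult (scl T) \<epsilon> n P = binom_mult (scl T) \<epsilon> n Q"
      "\<And>i j. P i j \<in> carr T" "\<And>i j. Q i j \<in> carr T" for \<epsilon> n P Q
    using that(1) Hom_binom_mult[OF T f, of P] Hom_binom_mult[OF T f, of Q] that(2,3)
    by (metis (no_types, lifting) ext)
  show ?thesis
    unfolding vertex_bilinear_def
  proof (intro conjI ballI allI)
    fix u v assume u: "u \<in> carr M" and v: "v \<in> carr N"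
    obtain m where "\<And>n. n < m \<Longrightarrow> F u v n = 0" by (rule laurent_bound[OF lau[OF u v]]) blast
    then show "(\<lambda>i. f (F u v i)) \<in> laurent (carr W)"
      using Fc[OF u v] fc by (auto simp: laurent_def Hom_0[OF f T] intro!: exI[of _ m])
    show "(\<lambda>i. f (F (der M u) v i)) = ddz (scl W) (\<lambda>i. f (F u v i))"
      using F u v by (simp add: vertex_bilinear_def ddz_def fscl Fc)
    show "f (F u (der N v) i) = der W (f (F u v i)) - ddz (scl W) (\<lambda>i. f (F u v i)) i" for i
    proof -
      have "F u (der N v) i = der T (F u v i) - ddz (scl T) (F u v) i"
        using F u v by (simp add: vertex_bilinear_def)
      then show ?thesis
        using u v by (simp add: ddz_def fdiff fscl fder Fc vertex_module_der[OF T]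
            vertex_module_subspace(3)[OF T])
    qed
    fix a assume a: "a \<in> carr V"
    obtain n k where
      n: "binom_mult (scl T) 1 n (shifted_op T a (F u v)) =
        binom_mult (scl T) 1 n (\<lambda>i j. F (vop M a u i) v j)" and
      k: "binom_mult (scl T) (- 1) k (\<lambda>i j. vop T a (F u v j) i) =
        binom_mult (scl T) (- 1) k (\<lambda>i j. F u (vop N a v i) j)"
      using F u v a unfolding vertex_bilinear_def by meson
    have "shifted_op W a (\<lambda>i. f (F u v i)) = (\<lambda>i j. f (shifted_op T a (F u v) i j))"
      by (intro ext) (simp add: Hom_shifted_op(1)[OF T f a lau[OF u v]])
    with fbinom[OF n] fbinom[OF k] show "\<exists>n k.
        binom_mult (scl W) 1 n (shifted_op W a (\<lambda>i. f (F u v i))) =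
        binom_mult (scl W) 1 n (\<lambda>i j. f (F (vop M a u i) v j)) \<and>
        binom_mult (scl W) (- 1) k (\<lambda>i j. vop W a (f (F u v j)) i) =
        binom_mult (scl W) (- 1) k (\<lambda>i j. f (F u (vop N a v i) j))"
      using u v by (intro exI[of _ n] exI[of _ k])
        (simp add: Hom_shifted_op(2)[OF T f a lau[OF u v]] fvop[OF a Fc[OF u v]] Fc
          vertex_module_vop[OF M a] vertex_module_vop[OF N a] vertex_module_vop[OF T a])
  next
    fix u assume u: "u \<in> carr M"
    then have "linear_on (scl N) (carr N) (pointwise (scl T)) (F u)"
      using F by (simp add: vertex_bilinear_def)
    then show "linear_on (scl N) (carr N) (pointwise (scl W)) (\<lambda>v i. f (F u v i))"
      using u by (simp add: linear_on_def pointwise_def fun_eq_iff fadd fscl Fc)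
  next
    fix v assume v: "v \<in> carr N"
    then have "linear_on (scl M) (carr M) (pointwise (scl T)) (\<lambda>u. F u v)"
      using F by (simp add: vertex_bilinear_def)
    then show "linear_on (scl M) (carr M) (pointwise (scl W)) (\<lambda>u i. f (F u v i))"
      using v by (simp add: linear_on_def pointwise_def fun_eq_iff fadd fscl Fc)
  qed
qed

text \<open>Lets \<open>tau\<close>, which is extended by zero, replace the composite of
  \<open>tens\<close> with a homomorphism; the two agree on the carriers.\<close>

lemma vertex_bilinear_cong:
  assumes M: "vertex_module V M" and N: "vertex_module V N"
    and eq: "\<And>u v. u \<in> carr M \<Longrightarrow> v \<in> carr N \<Longrightarrow> F u v = G u v"
    and F: "vertex_bilinear V M N W F"
  shows "vertex_bilinear V M N W G"
  using F unfolding vertex_bilinear_def linear_on_def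
  by (simp add: eq[symmetric] vertex_module_subspace[OF M] vertex_module_subspace[OF N]
      vertex_module_der[OF M] vertex_module_der[OF N]
      vertex_module_vop[OF M] vertex_module_vop[OF N])

section \<open>The adjunction\<close>

text \<open>\<open>T'\<close> lies in the universe of \<open>T\<close>, so the universal property of
  \<open>T\<close> applies to the pullback of \<open>tens'\<close> and gives the unique map that
  \<open>THE\<close> selects.\<close>

lemma tensor_hom:
  assumes T: "is_tensor V M N (T :: ('k::field_char_0, 'v::ab_group_add, 'u::ab_group_add) vmod) tens"
    and T': "is_tensor V M' N' (T' :: ('k, 'v, 'u) vmod) tens'"
    and f: "f \<in> Hom V M M'" and g: "g \<in> Hom V N N'"
  defines "h \<equiv> tensor_hom V M N T tens T' tens' f g"
  shows "h \<in> Hom V T T'"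
    and "u \<in> carr M \<Longrightarrow> v \<in> carr N \<Longrightarrow> h (tens u v i) = tens' (f u) (g v) i"
proof -
  have "vertex_module V T'" "vertex_bilinear V M N T' (\<lambda>u v. tens' (f u) (g v))"
    using T' vertex_bilinear_pull[OF f g] by (auto simp: is_tensor_def)
  then have "\<exists>!h. h \<in> Hom V T T' \<and>
      (\<forall>u\<in>carr M. \<forall>v\<in>carr N. \<forall>i. tens' (f u) (g v) i = h (tens u v i))"
    using T unfolding is_tensor_def by blast
  then have "\<exists>!h. h \<in> Hom V T T' \<and>
      (\<forall>u\<in>carr M. \<forall>v\<in>carr N. \<forall>i. h (tens u v i) = tens' (f u) (g v) i)"
    by (simp add: eq_commute)
  from theI'[OF this]
  show "h \<in> Hom V T T'" "u \<in> carr M \<Longrightarrow> v \<in> carr N \<Longrightarrow> h (tens u v i) = tens' (f u) (g v) i"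
    unfolding h_def tensor_hom_def by blast+
qed

text \<open>Existence in the universal property gives surjectivity and uniqueness gives injectivity,
  once homomorphisms into \<open>Vhom\<close> are read as vertex bilinear maps.\<close>

lemma bij_betw_tau:
  assumes M: "vertex_module V M" and N: "vertex_module V N"
    and W: "vertex_module V (W :: ('k::field_char_0, 'v::ab_group_add, 'u::ab_group_add) vmod)"
    and T: "is_tensor V M N (T :: ('k, 'v, 'u) vmod) tens"
  shows "bij_betw (tau M N tens) (Hom V T W) (Hom V M (Vhom V N W))"
proof -
  have mT: "vertex_module V T" and tens: "vertex_bilinear V M N T tens"
    using T by (auto simp: is_tensor_def)
  have univ: "\<exists>!\<phi>. \<phi> \<in> Hom V T W \<and> (\<forall>u\<in>carr M. \<forall>v\<in>carr N. \<forall>i. F u v i = \<phi> (tens u v i))"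
    if "vertex_bilinear V M N W F" for F
    using T W that unfolding is_tensor_def by blast
  have into: "tau M N tens f \<in> Hom V M (Vhom V N W)" if "f \<in> Hom V T W" for f
    by (rule vertex_bilinear_in_Hom[OF M N W vertex_bilinear_cong[OF M N _
            vertex_bilinear_push[OF M N mT that tens]]]) (auto simp: tau_def fun_eq_iff)
  show ?thesis
    unfolding bij_betw_def
  proof (intro conjI inj_onI equalityI subsetI)
    fix f g assume f: "f \<in> Hom V T W" and g: "g \<in> Hom V T W"
      and eq: "tau M N tens f = tau M N tens g"
    have "f (tens u v i) = g (tens u v i)" if "u \<in> carr M" "v \<in> carr N" for u v i
      using fun_cong[OF fun_cong[OF fun_cong[OF eq, of u], of v], of i] that by (simp add: tau_def)
    then show "f = g"
      using univ[OF vertex_bilinear_push[OF M N mT f tens]] f g by blast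
  next
    fix F assume F: "F \<in> Hom V M (Vhom V N W)"
    obtain f where f: "f \<in> Hom V T W"
      and eq: "\<And>u v i. u \<in> carr M \<Longrightarrow> v \<in> carr N \<Longrightarrow> F u v i = f (tens u v i)"
      using univ[OF Hom_Vhom_vertex_bilinear[OF M N W F]] by blast
    \<comment> \<open>Two conventions enter: \<open>F\<close> is zero off \<open>carr M\<close>, and
      each \<open>F u\<close> in \<open>Vhom\<close> is zero off \<open>carr N\<close>.\<close>
    have "F u v i = 0" if "u \<notin> carr M \<or> v \<notin> carr N" for u v i
    proof (cases "u \<in> carr M")
      case True
      then have "F u \<in> carr (Vhom V N W)" using F by (auto simp: Hom_def)
      then show ?thesis using that True by (simp add: Vhom_def)
    next
      case False
      then have "F u = 0" using F by (simp add: Hom_def)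
      then show ?thesis by simp
    qed
    then have "F = tau M N tens f"
      by (intro ext) (auto simp: tau_def eq)
    then show "F \<in> tau M N tens ` Hom V T W" using f by blast
  qed (use into in blast)
qed

text \<open>Surjectivity of \<open>q\<close> lets commutativity itself show that \<open>s\<close>
  maps into \<open>D\<close>.\<close>

lemma commuting_square_bij:
  assumes "bij_betw q A C" "bij_betw r B D" "\<And>x. x \<in> A \<Longrightarrow> p x \<in> B"
    and comm: "\<And>x. x \<in> A \<Longrightarrow> r (p x) = s (q x)"
  shows "commuting_square A B C D p q r s"
proof -
  have "s y \<in> D" if y: "y \<in> C" for y
  proof -
    obtain x where "x \<in> A" "y = q x" using y assms(1) by (auto simp: bij_betw_def)
    then have "s y = r (p x)" "p x \<in> B" using assms(3) comm by simp_all
    then show ?thesis using assms(2) by (auto simp: bij_betw_def)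
  qed
  then show ?thesis using assms by (auto simp: commuting_square_def bij_betw_def)
qed

text \<open>Serves naturality off the carriers, where \<open>f\<close> takes the value 0; this value
  lies in the target module, so \<open>tau\<close> evaluates the tensor there.\<close>

lemma is_tensor_0:
  assumes "vertex_module V M" "vertex_module V N" "is_tensor V M N T tens"
  shows "v \<in> carr N \<Longrightarrow> tens 0 v = 0" "u \<in> carr M \<Longrightarrow> tens u 0 = 0"
proof -
  have tens: "vertex_bilinear V M N T tens" using assms by (simp add: is_tensor_def)
  show "tens 0 v = 0" if v: "v \<in> carr N"
  proof (rule linear_on_0[OF _ vertex_module_subspace(1)[OF assms(1)]])
    show "linear_on (scl M) (carr M) (pointwise (scl T)) (\<lambda>u. tens u v)"
      using tens v by (simp add: vertex_bilinear_def)
  qed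
  show "tens u 0 = 0" if u: "u \<in> carr M"
  proof (rule linear_on_0[OF _ vertex_module_subspace(1)[OF assms(2)]])
    show "linear_on (scl N) (carr N) (pointwise (scl T)) (tens u)"
      using tens u by (simp add: vertex_bilinear_def)
  qed
qed

theorem theorem5p6:
  fixes V :: "('k::{alg_closed_field,field_char_0}, 'v::ab_group_add) valg"
    and M :: "('k, 'v, 'm::ab_group_add) vmod"
    and N :: "('k, 'v, 'n::ab_group_add) vmod"
    and W :: "('k, 'v, 'u::ab_group_add) vmod"
    and T :: "('k, 'v, 'u) vmod"
    and tens :: "'m \<Rightarrow> 'n \<Rightarrow> int \<Rightarrow> 'u"
  assumes "vertex_algebra V"
    and "vertex_module V M" and "vertex_module V N" and "vertex_module V W"
    and "is_tensor V M N T tens"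
  shows
    "vspace_iso (pointwise (scl W)) (Hom V T W)
       (pointwise (scl (Vhom V N W))) (Hom V M (Vhom V N W)) (tau M N tens) \<and>
     (\<forall>(M' :: ('k, 'v, 'm) vmod) (T' :: ('k, 'v, 'u) vmod) tens' f.
        vertex_module V M' \<longrightarrow> is_tensor V M' N T' tens' \<longrightarrow> f \<in> Hom V M M' \<longrightarrow>
        commuting_square
          (Hom V T' W) (Hom V T W) (Hom V M' (Vhom V N W)) (Hom V M (Vhom V N W))
          (\<lambda>g. g \<circ> tensor_hom V M N T tens T' tens' f (id_hom N))
          (tau M' N tens') (tau M N tens)
          (\<lambda>g. g \<circ> f)) \<and>
     (\<forall>(N' :: ('k, 'v, 'n) vmod) (T' :: ('k, 'v, 'u) vmod) tens' f.
        vertex_module V N' \<longrightarrow> is_tensor V M N' T' tens' \<longrightarrow> f \<in> Hom V N N' \<longrightarrow>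
        commuting_square
          (Hom V T' W) (Hom V T W) (Hom V M (Vhom V N' W)) (Hom V M (Vhom V N W))
          (\<lambda>g. g \<circ> tensor_hom V M N T tens T' tens' (id_hom M) f)
          (tau M N' tens') (tau M N tens)
          (\<lambda>g. Vhom_pull f \<circ> g)) \<and>
     (\<forall>(W' :: ('k, 'v, 'u) vmod) f.
        vertex_module V W' \<longrightarrow> f \<in> Hom V W W' \<longrightarrow>
        commuting_square
          (Hom V T W) (Hom V T W') (Hom V M (Vhom V N W)) (Hom V M (Vhom V N W'))
          (\<lambda>g. f \<circ> g)
          (tau M N tens) (tau M N tens)
          (\<lambda>g. Vhom_push f \<circ> g))"
proof (intro conjI allI impI)
  have M: "vertex_module V M" and N: "vertex_module V N" and W: "vertex_module V W"
    and T: "is_tensor V M N T tens" using assms by auto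
  have mT: "vertex_module V T" using T by (simp add: is_tensor_def)
  note bij = bij_betw_tau[OF M N W T]
  show "vspace_iso (pointwise (scl W)) (Hom V T W)
       (pointwise (scl (Vhom V N W))) (Hom V M (Vhom V N W)) (tau M N tens)"
  proof (rule vspace_iso_bij[OF vspace_on_Hom[OF mT W] _ _ bij])
    interpret W: char_0_vector_space "scl W" by (rule vertex_module_char_0[OF W])
    show "vector_space (pointwise (scl (Vhom V N W)) :: 'k \<Rightarrow> ('m \<Rightarrow> 'n \<Rightarrow> int \<Rightarrow> 'u) \<Rightarrow> _)"
      unfolding Vhom_def by (simp add: vector_space_pointwise W.vector_space_axioms)
    show "linear_on (pointwise (scl W)) (Hom V T W) (pointwise (scl (Vhom V N W))) (tau M N tens)"
      by (auto simp: linear_on_def tau_def pointwise_def Vhom_def fun_eq_iff)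
  qed
  {
    fix M' :: "('k, 'v, 'm) vmod" and T' :: "('k, 'v, 'u) vmod" and tens' f
    assume M': "vertex_module V M'" and T': "is_tensor V M' N T' tens'" and f: "f \<in> Hom V M M'"
    have mT': "vertex_module V T'" using T' by (simp add: is_tensor_def)
    note h = tensor_hom[OF T T' f id_hom_in_Hom[OF N]]
    show "commuting_square
          (Hom V T' W) (Hom V T W) (Hom V M' (Vhom V N W)) (Hom V M (Vhom V N W))
          (\<lambda>g. g \<circ> tensor_hom V M N T tens T' tens' f (id_hom N))
          (tau M' N tens') (tau M N tens)
          (\<lambda>g. g \<circ> f)"
    proof (rule commuting_square_bij[OF bij_betw_tau[OF M' N W T'] bij])
      fix g assume g: "g \<in> Hom V T' W"
      show "g \<circ> tensor_hom V M N T tens T' tens' f (id_hom N) \<in> Hom V T W"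
        by (rule Hom_comp[OF h(1) g mT'])
      have "f u \<in> carr M'" if "u \<in> carr M" for u using f that by (auto simp: Hom_def)
      moreover have "f u = 0" if "u \<notin> carr M" for u using f that by (auto simp: Hom_def)
      \<comment> \<open>Off \<open>carr M\<close> the right side is taken at \<open>f u = 0\<close>,
        where \<open>g (tens' 0 v i) = 0\<close>.\<close>
      ultimately show "tau M N tens (g \<circ> tensor_hom V M N T tens T' tens' f (id_hom N)) =
          tau M' N tens' g \<circ> f"
        using h(2) is_tensor_0(1)[OF M' N T'] Hom_0[OF g mT']
        by (auto simp: tau_def fun_eq_iff id_hom_def)
    qed
  next
    fix N' :: "('k, 'v, 'n) vmod" and T' :: "('k, 'v, 'u) vmod" and tens' f
    assume N': "vertex_module V N'" and T': "is_tensor V M N' T' tens'" and f: "f \<in> Hom V N N'"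
    have mT': "vertex_module V T'" using T' by (simp add: is_tensor_def)
    note h = tensor_hom[OF T T' id_hom_in_Hom[OF M] f]
    show "commuting_square
          (Hom V T' W) (Hom V T W) (Hom V M (Vhom V N' W)) (Hom V M (Vhom V N W))
          (\<lambda>g. g \<circ> tensor_hom V M N T tens T' tens' (id_hom M) f)
          (tau M N' tens') (tau M N tens)
          (\<lambda>g. Vhom_pull f \<circ> g)"
    proof (rule commuting_square_bij[OF bij_betw_tau[OF M N' W T'] bij])
      fix g assume g: "g \<in> Hom V T' W"
      show "g \<circ> tensor_hom V M N T tens T' tens' (id_hom M) f \<in> Hom V T W"
        by (rule Hom_comp[OF h(1) g mT'])
      have "f v \<in> carr N'" if "v \<in> carr N" for v using f that by (auto simp: Hom_def)
      moreover have "f v = 0" if "v \<notin> carr N" for v using f that by (auto simp: Hom_def)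
      ultimately show "tau M N tens (g \<circ> tensor_hom V M N T tens T' tens' (id_hom M) f) =
          Vhom_pull f \<circ> tau M N' tens' g"
        using h(2) is_tensor_0(2)[OF M N' T'] Hom_0[OF g mT']
        by (auto simp: tau_def fun_eq_iff id_hom_def Vhom_pull_def)
    qed
  next
    fix W' :: "('k, 'v, 'u) vmod" and f
    assume W': "vertex_module V W'" and f: "f \<in> Hom V W W'"
    show "commuting_square
          (Hom V T W) (Hom V T W') (Hom V M (Vhom V N W)) (Hom V M (Vhom V N W'))
          (\<lambda>g. f \<circ> g)
          (tau M N tens) (tau M N tens)
          (\<lambda>g. Vhom_push f \<circ> g)"
    proof (rule commuting_square_bij[OF bij bij_betw_tau[OF M N W' T]])
      fix g assume g: "g \<in> Hom V T W"
      show "f \<circ> g \<in> Hom V T W'" by (rule Hom_comp[OF g f W])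
      \<comment> \<open>\<open>f 0 = 0\<close> settles arguments off the carriers, where
        \<open>tau\<close> is zero before \<open>f\<close> is applied.\<close>
      show "tau M N tens (f \<circ> g) = Vhom_push f \<circ> tau M N tens g"
        using Hom_0[OF f W] by (auto simp: tau_def fun_eq_iff Vhom_push_def)
    qed
  }
qed

end
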